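(* Let $G$ be a brick. Then $G$ is matching double covered if and only if $G$ is (isomorphic to) the Petersen graph, $T_1$, or $K_4^6$.
   Context: Graphs are finite, loopless, and may have parallel edges (parallel edges are distinct edges, so perfect matchings differing only by the choice of a parallel edge are different). A connected graph is matching covered if every edge belongs to at least one perfect matching, and matching double covered if every edge belongs to exactly two perfect matchings. For $X\subseteq V(G)$, $\nabla(X)$ is the set of edges with exactly one end in $X$; it is a cut with shores $X$ and $V(G)\setminus X$, and it is trivial if one of its shores is a single vertex. A cut $C=\nabla(X)$ with $|X|$ odd in a matching covered graph is tight if $|C\cap M|=1$ for every perfect matching $M$. A brick is a nonbipartite matching covered graph with no nontrivial tight cut. $K_4^6$ is the graph obtained from $K_4$ by replacing every edge by two parallel edges. $T_1$ is the simple graph obtained from the complement $\overline{C_6}$ of the $6$-cycle $C_6$ by adding the three edges of a perfect matching of $C_6$; equivalently, $T_1$ is the octahedron $K_{2,2,2}$. *)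

theory Defs
  imports Main
begin

record ('v, 'e) mgraph =
  verts :: "'v set"
  edges :: "'e set"
  ends :: "'e \<Rightarrow> 'v set"

text \<open>Finite and loopless; distinct edges may have the same pair of ends (parallel edges).
  The value of \<open>ends\<close> outside \<open>edges\<close> is irrelevant.\<close>

definition graph :: "('v, 'e) mgraph \<Rightarrow> bool" where
  "graph G \<longleftrightarrow> finite (verts G) \<and> finite (edges G) \<and>
     (\<forall>e\<in>edges G. ends G e \<subseteq> verts G \<and> card (ends G e) = 2)"

definition adj :: "('v, 'e) mgraph \<Rightarrow> ('v \<times> 'v) set" where
  "adj G = {(u, v). \<exists>e\<in>edges G. ends G e = {u, v}}"

definition connected_graph :: "('v, 'e) mgraph \<Rightarrow> bool" where
  "connected_graph G \<longleftrightarrow> graph G \<and> verts G \<noteq> {} \<and>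
     (\<forall>u\<in>verts G. \<forall>v\<in>verts G. (u, v) \<in> (adj G)\<^sup>*)"

definition bipartite :: "('v, 'e) mgraph \<Rightarrow> bool" where
  "bipartite G \<longleftrightarrow> (\<exists>A B. A \<union> B = verts G \<and> A \<inter> B = {} \<and>
     (\<forall>e\<in>edges G. \<exists>a\<in>A. \<exists>b\<in>B. ends G e = {a, b}))"

text \<open>A perfect matching is a set of edges, so choosing a different parallel edge gives a
  different perfect matching.\<close>

definition perfect_matching :: "('v, 'e) mgraph \<Rightarrow> 'e set \<Rightarrow> bool" where
  "perfect_matching G M \<longleftrightarrow> M \<subseteq> edges G \<and> (\<forall>v\<in>verts G. \<exists>!e. e \<in> M \<and> v \<in> ends G e)"

definition matching_covered :: "('v, 'e) mgraph \<Rightarrow> bool" where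
  "matching_covered G \<longleftrightarrow> connected_graph G \<and>
     (\<forall>e\<in>edges G. \<exists>M. perfect_matching G M \<and> e \<in> M)"

definition matching_double_covered :: "('v, 'e) mgraph \<Rightarrow> bool" where
  "matching_double_covered G \<longleftrightarrow> connected_graph G \<and>
     (\<forall>e\<in>edges G. card {M. perfect_matching G M \<and> e \<in> M} = 2)"

definition cut :: "('v, 'e) mgraph \<Rightarrow> 'v set \<Rightarrow> 'e set" where
  "cut G X = {e \<in> edges G. card (ends G e \<inter> X) = 1}"

text \<open>Tightness and triviality are stated for a shore \<open>X\<close> rather than for the edge set
  \<open>cut G X\<close>; in a connected graph a cut determines its two shores.\<close>

definition tight_cut :: "('v, 'e) mgraph \<Rightarrow> 'v set \<Rightarrow> bool" where
  "tight_cut G X \<longleftrightarrow> X \<subseteq> verts G \<and> odd (card X) \<and>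
     (\<forall>M. perfect_matching G M \<longrightarrow> card (cut G X \<inter> M) = 1)"

definition trivial_cut :: "('v, 'e) mgraph \<Rightarrow> 'v set \<Rightarrow> bool" where
  "trivial_cut G X \<longleftrightarrow> card X = 1 \<or> card (verts G - X) = 1"

definition brick :: "('v, 'e) mgraph \<Rightarrow> bool" where
  "brick G \<longleftrightarrow> matching_covered G \<and> \<not> bipartite G \<and>
     (\<forall>X. tight_cut G X \<longrightarrow> trivial_cut G X)"

definition isomorphic :: "('v, 'e) mgraph \<Rightarrow> ('w, 'f) mgraph \<Rightarrow> bool" where
  "isomorphic G H \<longleftrightarrow> (\<exists>f g. bij_betw f (verts G) (verts H) \<and> bij_betw g (edges G) (edges H) \<and>
     (\<forall>e\<in>edges G. ends H (g e) = f ` ends G e))"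

definition simple_graph :: "'v set \<Rightarrow> 'v set set \<Rightarrow> ('v, 'v set) mgraph" where
  "simple_graph V E = \<lparr>verts = V, edges = E, ends = (\<lambda>e. e)\<rparr>"

definition all_pairs :: "'v set \<Rightarrow> 'v set set" where
  "all_pairs V = {e. e \<subseteq> V \<and> card e = 2}"

text \<open>The Petersen graph as the Kneser graph on the 2-subsets of a 5-set.\<close>

definition petersen :: "(nat set, nat set set) mgraph" where
  "petersen = simple_graph (all_pairs {..<5})
     {{A, B} | A B. A \<in> all_pairs {..<5} \<and> B \<in> all_pairs {..<5} \<and> A \<inter> B = {}}"

definition C6_edges :: "nat set set" where
  "C6_edges = {{i, Suc i mod 6} | i. i < 6}"

definition T1 :: "(nat, nat set) mgraph" where
  "T1 = simple_graph {..<6} ((all_pairs {..<6} - C6_edges) \<union> {{0, 1}, {2, 3}, {4, 5}})"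

text \<open>The edges \<open>(e, False)\<close> and \<open>(e, True)\<close> are the two parallel copies of the edge \<open>e\<close> of
  the complete graph on four vertices.\<close>

definition K4_6 :: "(nat, nat set \<times> bool) mgraph" where
  "K4_6 = \<lparr>verts = {..<4}, edges = all_pairs {..<4} \<times> UNIV, ends = fst\<rparr>"

end

theory Submission
  imports Defs Complex_Main
begin

text \<open>Counting the perfect matchings at each vertex shows that a matching double covered graph is
  \<open>d\<close>-regular and has exactly \<open>2 d\<close> perfect matchings. In a brick no nontrivial odd cut is tight, so by
  Edmonds' perfect matching polytope theorem the perfect matchings span the space of all edge
  vectors with equal sums at all vertices. On \<open>n\<close> vertices this gives
  \<open>n d / 2 - n + 1 \<le> 2 d\<close>, which leaves \<open>n = 4\<close>, or \<open>n = 6\<close> and \<open>d \<le> 5\<close>, or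
  \<open>n \<le> 10\<close> and \<open>d = 3\<close>. In these cases the edge multiplicities are determined by three
  conditions: for an edge \<open>u v\<close>, the graph without \<open>u\<close> and \<open>v\<close> has exactly two perfect
  matchings; every nontrivial odd cut has more than \<open>d\<close> edges; the graph is not bipartite.
  For \<open>d = 3\<close> they exclude triangles and 4-cycles, which leaves the Petersen graph.\<close>

section \<open>Fractional perfect matchings and contractions\<close>

text \<open>Edmonds' theorem enters in weighted form: for every weight vector and every point
  \<open>x\<close> of the polytope, some perfect matching weighs at least as much as
  \<open>x\<close>. This can be proved by induction without convex combinations, and it suffices,
  because the dimension count only has to refute one vector orthogonal to all perfect matchings. The
  point to perturb is the uniform vector \<open>1 / d\<close>. Every perfect matching meets an odd
  cut \<open>C\<close> in an odd number of edges, and one of them meets a nontrivial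
  \<open>C\<close> at least three times, so double counting gives
  \<open>2 * |C| \<ge> 2 * d + 2\<close>; this slack leaves room in every direction that respects
  the vertex equations. The inequality compares \<open>n * d / 2\<close> unknowns minus
  \<open>n - 1\<close> vertex conditions with the \<open>2 * d\<close> matchings. It reads
  \<open>d * (n - 4) \<le> 2 * n - 2\<close> and becomes effective through \<open>d \<ge> 3\<close>,
  which comes from the odd cuts around triples of vertices. After that the graph is seen only
  through its multiplicities; this loses nothing, since parallel edges can be permuted
  freely.\<close>

lemma homogeneous_solution:
  fixes a :: "'i \<Rightarrow> 'e \<Rightarrow> 'a::field"
  assumes "finite I" "finite E" "card I < card E"
  shows "\<exists>f. (\<exists>e\<in>E. f e \<noteq> 0) \<and> (\<forall>i\<in>I. (\<Sum>e\<in>E. a i e * f e) = 0)"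
  using assms
proof (induction I arbitrary: E a rule: finite_induct)
  case empty
  then have "E \<noteq> {}" by auto
  then show ?case by (intro exI[of _ "\<lambda>_. 1"]) auto
next
  case (insert i I)
  show ?case
  proof (cases "\<forall>e\<in>E. a i e = 0")
    case True
    moreover have "card I < card E" using insert by auto
    ultimately show ?thesis using insert.IH[of E a] insert.prems by auto
  next
    case False
    then obtain e0 where e0: "e0 \<in> E" "a i e0 \<noteq> 0" by auto
    \<comment> \<open>Gaussian elimination: equation \<open>i\<close> is solved for the unknown at
      \<open>e0\<close>; substituting the result \<open>c\<close> leaves one equation and one
      unknown less.\<close>
    define E' where "E' = E - {e0}"
    have E: "E = insert e0 E'" "e0 \<notin> E'" "finite E'"
      using e0 insert.prems by (auto simp: E'_def)
    then have "card I < card E'" using insert by auto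
    then obtain f where f: "\<exists>e\<in>E'. f e \<noteq> 0"
      "\<forall>j\<in>I. (\<Sum>e\<in>E'. (a j e - a j e0 * a i e / a i e0) * f e) = 0"
      using insert.IH[of E' "\<lambda>j e. a j e - a j e0 * a i e / a i e0"] E by blast
    define c where "c = - (\<Sum>e\<in>E'. a i e * f e) / a i e0"
    define g where "g = f(e0 := c)"
    have gs: "(\<Sum>e\<in>E. a j e * g e) = (\<Sum>e\<in>E'. a j e * f e) + a j e0 * c" for j
    proof -
      have "(\<Sum>e\<in>E'. a j e * g e) = (\<Sum>e\<in>E'. a j e * f e)"
        using E(2) by (intro sum.cong) (auto simp: g_def)
      then show ?thesis using E by (simp add: g_def)
    qed
    have "(\<Sum>e\<in>E. a i e * g e) = 0"
      unfolding gs c_def using e0 by simp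
    moreover have "(\<Sum>e\<in>E. a j e * g e) = 0" if "j \<in> I" for j
    proof -
      have "0 = (\<Sum>e\<in>E'. a j e * f e - (a j e0 / a i e0) * (a i e * f e))"
        using bspec[OF f(2) that] by (simp add: left_diff_distrib mult.assoc)
      also have "\<dots> = (\<Sum>e\<in>E'. a j e * f e) + a j e0 * c"
        by (simp add: sum_subtractf sum_distrib_left[symmetric]
        sum_divide_distrib[symmetric] c_def)
      finally show ?thesis by (simp add: gs)
    qed
    moreover have "\<exists>e\<in>E. g e \<noteq> 0" using f(1) E by (auto simp: g_def)
    ultimately show ?thesis by blast
  qed
qed

lemma graph_finite [simp]:
  "graph G \<Longrightarrow> finite (verts G)" "graph G \<Longrightarrow> finite (edges G)"
  by (auto simp: graph_def)

lemma graph_ends: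
  assumes "graph G" "e \<in> edges G"
  shows "ends G e \<subseteq> verts G" "card (ends G e) = 2"
  using assms unfolding graph_def by blast+

lemma ends_obtain:
  assumes "graph G" "e \<in> edges G"
  obtains p q where "ends G e = {p, q}" "p \<noteq> q" "p \<in> verts G" "q \<in> verts G"
  using assms unfolding graph_def card_2_iff by (metis insert_subset)

lemma other_end:
  assumes "graph G" "e \<in> edges G" "v \<in> ends G e"
  obtains u where "ends G e = {v, u}" "u \<noteq> v" "u \<in> verts G" "v \<in> verts G"
proof -
  obtain p q where pq: "ends G e = {p, q}" "p \<noteq> q" "p \<in> verts G" "q \<in> verts G"
    using ends_obtain[OF assms(1,2)] .
  show ?thesis
  proof (cases "v = p")
    case True
    then show ?thesis using that[of q] pq by simp
  next
    case False
    then show ?thesis using that[of p] pq assms(3) by (simp add: insert_commute)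
  qed
qed

lemma card_inter_pair:
  "p \<noteq> q \<Longrightarrow> card ({p, q} \<inter> S) = (if p \<in> S then 1 else 0) + (if q \<in> S then 1 else 0)"
  by (auto simp: Int_insert_left)

lemma finite_cut [simp]: "graph G \<Longrightarrow> finite (cut G S)"
  by (simp add: cut_def)

lemma cut_singleton: "cut G {v} = {e \<in> edges G. v \<in> ends G e}"
  by (auto simp: cut_def Int_insert_right)

lemma cut_compl:
  assumes "graph G" "S \<subseteq> verts G"
  shows "cut G (verts G - S) = cut G S"
proof -
  have "card (ends G e \<inter> (verts G - S)) = 1 \<longleftrightarrow> card (ends G e \<inter> S) = 1"
    if e: "e \<in> edges G" for e
  proof -
    obtain p q where "ends G e = {p, q}" "p \<noteq> q" "p \<in> verts G" "q \<in> verts G"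
      using ends_obtain[OF assms(1) e] by metis
    then show ?thesis by (simp add: card_inter_pair)
  qed
  then show ?thesis unfolding cut_def by blast
qed

lemma cut_empty: "cut G {} = {}"
  by (simp add: cut_def)

lemma cut_verts:
  assumes "graph G" shows "cut G (verts G) = {}"
  using cut_compl[OF assms, of "{}"] by (simp add: cut_empty)

lemma sum_cut_singletons:
  fixes x :: "'e \<Rightarrow> 'a::comm_semiring_1"
  assumes "graph G" "S \<subseteq> verts G"
  shows "(\<Sum>v\<in>S. \<Sum>e\<in>cut G {v}. x e) = (\<Sum>e\<in>edges G. of_nat (card (ends G e \<inter> S)) * x e)"
proof -
  have fS: "finite S" using assms by (metis finite_subset graph_finite(1))
  have "(\<Sum>v\<in>S. \<Sum>e\<in>cut G {v}. x e) = (\<Sum>v\<in>S. \<Sum>e\<in>edges G. if v \<in> ends G e then x e else 0)"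
    using assms by (simp add: cut_singleton sum.inter_filter)
  also have "\<dots> = (\<Sum>e\<in>edges G. \<Sum>v\<in>S. if v \<in> ends G e then x e else 0)"
    by (rule sum.swap)
  also have "\<dots> = (\<Sum>e\<in>edges G. of_nat (card (ends G e \<inter> S)) * x e)"
  proof (rule sum.cong[OF refl])
    fix e
    have "(\<Sum>v\<in>S. if v \<in> ends G e then x e else 0) = (\<Sum>v\<in>{v \<in> S. v \<in> ends G e}. x e)"
      by (rule sum.inter_filter[OF fS, symmetric])
    also have "{v \<in> S. v \<in> ends G e} = ends G e \<inter> S" by auto
    finally show "(\<Sum>v\<in>S. if v \<in> ends G e then x e else 0) = of_nat (card (ends G e \<inter> S)) * x e"
      by simp
  qed
  finally show ?thesis .
qed

lemma sum_cut_singletons_verts: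
  fixes x :: "'e \<Rightarrow> 'a::comm_semiring_1"
  assumes "graph G"
  shows "(\<Sum>v\<in>verts G. \<Sum>e\<in>cut G {v}. x e) = 2 * (\<Sum>e\<in>edges G. x e)"
proof -
  have "of_nat (card (ends G e \<inter> verts G)) * x e = 2 * x e" if "e \<in> edges G" for e
  proof -
    have "ends G e \<inter> verts G = ends G e" "card (ends G e) = 2"
      using graph_ends[OF assms that] by (simp_all add: Int_absorb2)
    then show ?thesis by simp
  qed
  then show ?thesis unfolding sum_cut_singletons[OF assms order.refl] sum_distrib_left
    by (rule sum.cong[OF refl])
qed

text \<open>An edge inside \<open>S\<close> is met from both ends, a cut edge from one. Applied to a
  matching this gives parity on odd cuts, applied to a fractional matching it detects tight
  triples.\<close>

lemma sum_cut_singletons_split: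
  fixes x :: "'e \<Rightarrow> 'a::comm_semiring_1"
  assumes "graph G" "S \<subseteq> verts G"
  shows "(\<Sum>v\<in>S. \<Sum>e\<in>cut G {v}. x e) =
    (\<Sum>e\<in>cut G S. x e) + 2 * (\<Sum>e\<in>{e \<in> edges G. ends G e \<subseteq> S}. x e)"
proof -
  have "of_nat (card (ends G e \<inter> S)) * x e =
    (if card (ends G e \<inter> S) = 1 then x e else 0) + (if ends G e \<subseteq> S then 2 * x e else 0)"
    if e: "e \<in> edges G" for e
  proof -
    obtain p q where "ends G e = {p, q}" "p \<noteq> q" using ends_obtain[OF assms(1) e] by metis
    then show ?thesis by (auto simp: card_inter_pair)
  qed
  then have "(\<Sum>v\<in>S. \<Sum>e\<in>cut G {v}. x e) = (\<Sum>e\<in>edges G.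
    (if card (ends G e \<inter> S) = 1 then x e else 0) + (if ends G e \<subseteq> S then 2 * x e else 0))"
    unfolding sum_cut_singletons[OF assms] by (rule sum.cong[OF refl])
  also have "\<dots> = (\<Sum>e\<in>cut G S. x e) + (\<Sum>e\<in>{e \<in> edges G. ends G e \<subseteq> S}. 2 * x e)"
    using assms(1) by (simp only: sum.distrib cut_def sum.inter_filter graph_finite)
  finally show ?thesis by (simp add: sum_distrib_left)
qed

text \<open>These are the points of Edmonds' polytope with full support. Because values are strictly
  positive, an edge whose value reaches zero has to be deleted, which is one of the ways in which
  the induction progresses.\<close>

definition frac_pm :: "('v, 'e) mgraph \<Rightarrow> ('e \<Rightarrow> real) \<Rightarrow> bool" where
  "frac_pm G x \<longleftrightarrow> graph G \<and> (\<forall>e\<in>edges G. x e > 0) \<and>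
    (\<forall>v\<in>verts G. (\<Sum>e\<in>cut G {v}. x e) = 1) \<and>
    (\<forall>S\<subseteq>verts G. odd (card S) \<longrightarrow> (\<Sum>e\<in>cut G S. x e) \<ge> 1)"

lemma frac_pmD:
  assumes "frac_pm G x"
  shows "graph G" "e \<in> edges G \<Longrightarrow> x e > 0" "v \<in> verts G \<Longrightarrow> (\<Sum>e\<in>cut G {v}. x e) = 1"
    "S \<subseteq> verts G \<Longrightarrow> odd (card S) \<Longrightarrow> (\<Sum>e\<in>cut G S. x e) \<ge> 1"
  using assms by (auto simp: frac_pm_def)

lemma frac_pm_even:
  assumes "frac_pm G x" shows "even (card (verts G))"
proof (rule ccontr)
  assume "odd (card (verts G))"
  then have "(\<Sum>e\<in>cut G (verts G). x e) \<ge> 1" using frac_pmD(4)[OF assms] by blast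
  then show False using cut_verts[OF frac_pmD(1)[OF assms]] by simp
qed

text \<open>The set \<open>U\<close> shrinks to one of its own vertices and the surviving edges keep
  their names, so the types do not change and edge vectors restrict without translation.\<close>

definition contract :: "('v, 'e) mgraph \<Rightarrow> 'v set \<Rightarrow> 'v \<Rightarrow> ('v, 'e) mgraph" where
  "contract G U u = \<lparr>verts = insert u (verts G - U), edges = {e \<in> edges G. \<not> ends G e \<subseteq> U},
     ends = (\<lambda>e. (\<lambda>v. if v \<in> U then u else v) ` ends G e)\<rparr>"

lemma graph_contract:
  assumes "graph G" "u \<in> U"
  shows "graph (contract G U u)"
proof -
  have "(\<lambda>v. if v \<in> U then u else v) ` ends G e \<subseteq> insert u (verts G - U)
    \<and> card ((\<lambda>v. if v \<in> U then u else v) ` ends G e) = 2"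
    if e: "e \<in> edges G" "\<not> ends G e \<subseteq> U" for e
  proof -
    obtain p q where pq: "ends G e = {p, q}" "p \<noteq> q" "p \<in> verts G" "q \<in> verts G"
      using ends_obtain[OF assms(1) e(1)] by metis
    have "(if p \<in> U then u else p) \<noteq> (if q \<in> U then u else q)"
      using e(2) pq(1,2) assms(2) by (simp split: if_splits) metis
    then show ?thesis using pq(3,4) unfolding pq(1) image_insert image_empty by simp
  qed
  then show ?thesis using assms(1) unfolding contract_def graph_def by auto
qed

text \<open>The shore on the right is the preimage of \<open>S\<close> under the contraction map. An
  edge lost in the contraction has both ends in \<open>U\<close>, hence on the same side of that
  preimage.\<close>

lemma cut_contract:
  assumes "graph G" "u \<in> U" "S \<subseteq> verts (contract G U u)"
  shows "cut (contract G U u) S = cut G (if u \<in> S then S \<union> U else S)"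
proof -
  let ?\<phi> = "\<lambda>v. if v \<in> U then u else v"
  let ?S = "if u \<in> S then S \<union> U else S"
  have S: "S \<inter> U \<subseteq> {u}" using assms(2,3) by (auto simp: contract_def)
  have "\<not> ends G e \<subseteq> U \<and> card (?\<phi> ` ends G e \<inter> S) = 1 \<longleftrightarrow> card (ends G e \<inter> ?S) = 1"
    if e: "e \<in> edges G" for e
  proof -
    obtain p q where pq: "ends G e = {p, q}" "p \<noteq> q"
      using ends_obtain[OF assms(1) e] by metis
    have im: "?\<phi> v \<in> S \<longleftrightarrow> v \<in> ?S" for v using S assms(2) by auto
    show ?thesis
    proof (cases "ends G e \<subseteq> U")
      case True
      then have "p \<in> ?S \<longleftrightarrow> q \<in> ?S" using pq S by auto
      then show ?thesis using True pq by (simp only: card_inter_pair) auto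
    next
      case False
      then have "?\<phi> p \<noteq> ?\<phi> q" using pq assms(2) by auto
      then have "card (?\<phi> ` ends G e \<inter> S) = card (ends G e \<inter> ?S)"
        using pq by (simp only: card_inter_pair im image_insert image_empty simp_thms)
      then show ?thesis using False by simp
    qed
  qed
  then have "{e \<in> edges G. \<not> ends G e \<subseteq> U \<and> card (?\<phi> ` ends G e \<inter> S) = 1} = cut G ?S"
    unfolding cut_def by blast
  moreover have "cut (contract G U u) S =
      {e \<in> edges G. \<not> ends G e \<subseteq> U \<and> card (?\<phi> ` ends G e \<inter> S) = 1}"
    by (auto simp: cut_def contract_def)
  ultimately show ?thesis by simp
qed

text \<open>Replacing \<open>u\<close> by the odd set \<open>U\<close> keeps the parity of a shore,
  so odd cuts come from odd cuts. The tightness of \<open>U\<close> is the equation at the new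
  vertex.\<close>

lemma frac_pm_contract:
  assumes x: "frac_pm G x" and U: "U \<subseteq> verts G" "odd (card U)" "(\<Sum>e\<in>cut G U. x e) = 1" and u: "u \<in> U"
  shows "frac_pm (contract G U u) x"
proof -
  note G = frac_pmD(1)[OF x]
  have fin: "finite U" using G U by (metis finite_subset graph_finite(1))
  have "(\<Sum>e\<in>cut (contract G U u) {v}. x e) = 1" if "v \<in> verts (contract G U u)" for v
  proof (cases "v = u")
    case True
    have "{u} \<union> U = U" using u by auto
    then show ?thesis using cut_contract[OF G u, of "{v}"] that U True by simp
  next
    case False
    then show ?thesis using cut_contract[OF G u, of "{v}"] that frac_pmD(3)[OF x, of v]
      by (auto simp: contract_def)
  qed
  moreover have "(\<Sum>e\<in>cut (contract G U u) S. x e) \<ge> 1"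
    if S: "S \<subseteq> verts (contract G U u)" "odd (card S)" for S
  proof -
    let ?S = "if u \<in> S then S \<union> U else S"
    have fS: "finite S" using S(1) graph_contract[OF G u] by (metis finite_subset graph_finite(1))
    have "odd (card ?S)"
    proof (cases "u \<in> S")
      case True
      then have "S \<union> U = (S - {u}) \<union> U" using u by auto
      moreover have "(S - {u}) \<inter> U = {}" using S(1) by (auto simp: contract_def)
      ultimately have "card (S \<union> U) = card (S - {u}) + card U"
        using fin fS by (simp add: card_Un_disjoint)
      moreover have "even (card (S - {u}))" using S(2) True fS by simp
      ultimately show ?thesis using True U by simp
    next
      case False then show ?thesis using S by simp
    qed
    moreover have "?S \<subseteq> verts G" using S(1) U(1) u by (auto simp: contract_def)
    ultimately show ?thesis using cut_contract[OF G u S(1)] frac_pmD(4)[OF x, of ?S] by simp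
  qed
  ultimately show ?thesis using graph_contract[OF G u] frac_pmD(2)[OF x]
    by (auto simp: frac_pm_def contract_def)
qed

lemma perfect_matching_cut_singleton:
  "perfect_matching G M \<Longrightarrow> v \<in> verts G \<Longrightarrow> \<exists>e. M \<inter> cut G {v} = {e}"
  unfolding perfect_matching_def cut_singleton by (auto simp: subset_iff) blast

text \<open>A vertex outside \<open>U\<close> is covered once by \<open>M1\<close>, and an edge of
  \<open>M2\<close> that reaches it crosses the cut, so it is the shared edge \<open>e\<close>. The
  vertices of \<open>U\<close> are symmetric; \<open>half\<close> serves both sides.\<close>

lemma perfect_matching_glue:
  assumes G: "graph G" and U: "U \<subseteq> verts G" "u \<in> U" "u' \<in> verts G - U"
    and M1: "perfect_matching (contract G U u) M1"
    and M2: "perfect_matching (contract G (verts G - U) u') M2"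
    and e: "M1 \<inter> cut G U = {e}" "M2 \<inter> cut G U = {e}"
  shows "perfect_matching G (M1 \<union> M2)"
proof -
  have half: "\<exists>!e. e \<in> M \<union> N \<and> v \<in> ends G e"
    if U: "U \<subseteq> verts G" "u \<in> U" "u' \<in> verts G - U" and v: "v \<in> verts G - U"
      and M: "perfect_matching (contract G U u) M"
      and N: "perfect_matching (contract G (verts G - U) u') N"
      and e: "e \<in> M" "N \<inter> cut G U = {e}" for U u u' M N v
  proof -
    have "v \<in> verts (contract G U u)" using v by (auto simp: contract_def)
    moreover have "v \<in> ends (contract G U u) f \<longleftrightarrow> v \<in> ends G f" for f
      using v U by (auto simp: contract_def image_iff)
    ultimately have ex1: "\<exists>!f. f \<in> M \<and> v \<in> ends G f"
      using M unfolding perfect_matching_def by (metis (no_types, lifting))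
    have "f = e" if f: "f \<in> N" "v \<in> ends G f" for f
    proof -
      have fE: "f \<in> edges G" "\<not> ends G f \<subseteq> verts G - U"
        using N f unfolding perfect_matching_def contract_def by auto
      obtain p q where "ends G f = {p, q}" "p \<noteq> q" "p \<in> verts G" "q \<in> verts G"
        using ends_obtain[OF G fE(1)] by metis
      then have "f \<in> cut G U" using fE f v by (auto simp: cut_def card_inter_pair)
      then show ?thesis using f e by auto
    qed
    then show ?thesis using ex1 e by blast
  qed
  have "M1 \<union> M2 \<subseteq> edges G"
    using M1 M2 unfolding perfect_matching_def contract_def by auto
  moreover have "\<exists>!f. f \<in> M1 \<union> M2 \<and> v \<in> ends G f" if v: "v \<in> verts G" for v
  proof (cases "v \<in> U")
    case False
    then show ?thesis using half[OF U _ M1 M2 _ e(2), of v] e(1) v by blast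
  next
    case True
    have *: "verts G - (verts G - U) = U" using U by auto
    have "\<exists>!f. f \<in> M2 \<union> M1 \<and> v \<in> ends G f"
      by (rule half[of "verts G - U" u' u v M2 M1])
        (use U True v M1 M2 e in \<open>auto simp: * cut_compl[OF G U(1)]\<close>)
    then show ?thesis by (simp add: Un_commute)
  qed
  ultimately show ?thesis by (auto simp: perfect_matching_def)
qed

text \<open>Perfect matchings of the two contractions that share their edge in the cut are glued. To make
  optimal choices on both sides compatible, the best weight attainable inside \<open>U\<close> together with a
  cut edge \<open>e\<close> is added to the weight of \<open>e\<close> on one side and replaces it, negated, on the other.\<close>
lemma edmonds_glue:
  fixes G :: "('v, 'e) mgraph"
  assumes x: "frac_pm G x"
    and U: "U \<subseteq> verts G" "odd (card U)" "card U \<noteq> 1" "card (verts G - U) \<noteq> 1"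
    and tight: "(\<Sum>e\<in>cut G U. x e) = 1"
    and IH: "\<And>(G' :: ('v, 'e) mgraph) w'. card (verts G') < card (verts G) \<Longrightarrow> edges G' \<subseteq> edges G
      \<Longrightarrow> frac_pm G' x \<Longrightarrow>
      \<exists>M. perfect_matching G' M \<and> (\<Sum>e\<in>M. w' e) \<ge> (\<Sum>e\<in>edges G'. w' e * x e)"
  shows "\<exists>M. perfect_matching G M \<and> (\<Sum>e\<in>M. w e) \<ge> (\<Sum>e\<in>edges G. w e * x e)"
proof -
  note G = frac_pmD(1)[OF x]
  have finV: "finite (verts G)" and finE: "finite (edges G)" using G by auto
  have finU: "finite U" using U(1) finV finite_subset by blast
  have cV: "card (verts G) = card U + card (verts G - U)"
    using card_Diff_subset[OF finU U(1)] card_mono[OF finV U(1)] by simp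
  then have oddU': "odd (card (verts G - U))" using frac_pm_even[OF x] U(2) by simp
  have ge: "card U \<ge> 3" "card (verts G - U) \<ge> 3"
    using U(2-4) oddU' by presburger+
  obtain u where u: "u \<in> U" using ge by (cases "U = {}") auto
  obtain u' where u': "u' \<in> verts G - U" using ge by (cases "verts G - U = {}") auto
  define C where "C = cut G U"
  define I where "I = {e \<in> edges G. ends G e \<subseteq> U}"
  define Q where "Q = {e \<in> edges G. ends G e \<subseteq> verts G - U}"
  define G1 where "G1 = contract G U u"
  define G2 where "G2 = contract G (verts G - U) u'"
  have dbl: "verts G - (verts G - U) = U" using U(1) by auto
  have fr1: "frac_pm G1 x" unfolding G1_def by (rule frac_pm_contract[OF x U(1,2) tight u])
  have fr2: "frac_pm G2 x" unfolding G2_def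
    by (rule frac_pm_contract[OF x _ oddU' _ u']) (use tight cut_compl[OF G U(1)] in auto)
  have c1: "card (verts G1) < card (verts G)"
    using finV u ge cV by (simp add: G1_def contract_def)
  have c2: "card (verts G2) < card (verts G)"
    using finU u' ge cV by (simp add: G2_def contract_def dbl)
  have part: "(e \<in> C \<and> e \<notin> I \<and> e \<notin> Q) \<or> (e \<notin> C \<and> e \<in> I \<and> e \<notin> Q) \<or> (e \<notin> C \<and> e \<notin> I \<and> e \<in> Q)"
    if e: "e \<in> edges G" for e
  proof -
    obtain p q where "ends G e = {p, q}" "p \<noteq> q" "p \<in> verts G" "q \<in> verts G"
      using ends_obtain[OF G e] by metis
    then show ?thesis using e U(1) by (auto simp: C_def I_def Q_def cut_def card_inter_pair)
  qed
  have sub: "C \<subseteq> edges G" "I \<subseteq> edges G" "Q \<subseteq> edges G" by (auto simp: C_def I_def Q_def cut_def)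
  have E1: "edges G1 = C \<union> Q"
  proof -
    have "edges G1 = edges G - I" by (auto simp: G1_def contract_def I_def)
    then show ?thesis using part sub by blast
  qed
  have E2: "edges G2 = C \<union> I"
  proof -
    have "edges G2 = edges G - Q" by (auto simp: G2_def contract_def Q_def)
    then show ?thesis using part sub by blast
  qed
  have E: "edges G = (C \<union> Q) \<union> I" using part sub by blast
  have disj: "C \<inter> Q = {}" "C \<inter> I = {}" "(C \<union> Q) \<inter> I = {}" using part sub by blast+
  have fin: "finite C" "finite Q" "finite I" using sub finE finite_subset by blast+
  have cut1: "\<exists>e. M \<inter> C = {e}" if "perfect_matching G1 M" for M
  proof -
    have v: "u \<in> verts G1" by (simp add: G1_def contract_def)
    have "cut G1 {u} = C"
      using cut_contract[OF G u, of "{u}"] v u by (simp add: G1_def C_def insert_absorb)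
    then show ?thesis using perfect_matching_cut_singleton[OF that v] by simp
  qed
  have cut2: "\<exists>e. M \<inter> C = {e}" if "perfect_matching G2 M" for M
  proof -
    have v: "u' \<in> verts G2" by (simp add: G2_def contract_def)
    have "cut G2 {u'} = C"
      using cut_contract[OF G u', of "{u'}"] v u' cut_compl[OF G U(1)]
      by (simp add: G2_def C_def insert_absorb)
    then show ?thesis using perfect_matching_cut_singleton[OF that v] by simp
  qed
  define P where "P e = {M. perfect_matching G2 M \<and> e \<in> M}" for e
  define g where "g M = (\<Sum>e\<in>M \<inter> I. w e)" for M
  have "\<exists>N\<in>P e. \<forall>M\<in>P e. g M \<le> g N" if e: "e \<in> C" for e
  proof -
    \<comment> \<open>For the weight that is 1 on \<open>e\<close> and 0 elsewhere, the induction
      hypothesis yields a perfect matching through \<open>e\<close>, because \<open>x e\<close> is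
      positive.\<close>
    obtain M where M: "perfect_matching G2 M"
      "(\<Sum>f\<in>M. of_bool (f = e)) \<ge> (\<Sum>f\<in>edges G2. of_bool (f = e) * x f)"
      using IH[OF c2 _ fr2, of "\<lambda>f. of_bool (f = e)"] sub E2 by auto
    have "(\<Sum>f\<in>edges G2. of_bool (f = e) * x f) = x e"
      using e E2 fin by (simp add: of_bool_def if_distrib if_distribR sum.delta cong: if_cong)
    moreover have "x e > 0" using e sub frac_pmD(2)[OF x] by auto
    ultimately have "(\<Sum>f\<in>M. of_bool (f = e) :: real) \<noteq> 0" using M(2) by linarith
    moreover have "(\<Sum>f\<in>M. of_bool (f = e) :: real) = 0" if "e \<notin> M"
      using that by (intro sum.neutral) auto
    ultimately have "e \<in> M" by blast
    then have "P e \<noteq> {}" using M(1) by (auto simp: P_def)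
    moreover have "finite (P e)"
      by (rule finite_subset[of _ "Pow (edges G2)"]) (use fin E2 in \<open>auto simp: P_def perfect_matching_def\<close>)
    ultimately have "Max (g ` P e) \<in> g ` P e" "\<And>M. M \<in> P e \<Longrightarrow> g M \<le> Max (g ` P e)" by auto
    then show ?thesis by (metis imageE)
  qed
  then obtain N where N: "\<And>e. e \<in> C \<Longrightarrow> N e \<in> P e" "\<And>e M. e \<in> C \<Longrightarrow> M \<in> P e \<Longrightarrow> g M \<le> g (N e)"
    by metis
  have split: "M = insert e (M \<inter> I) \<and> e \<notin> I \<and> e \<in> C" if "perfect_matching G2 M" "M \<inter> C = {e}" for M e
  proof -
    have "M \<subseteq> C \<union> I" using that(1) E2 by (auto simp: perfect_matching_def)
    then show ?thesis using that(2) disj by blast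
  qed
  have sum2: "(\<Sum>f\<in>M. h f) = h e + (\<Sum>f\<in>M \<inter> I. h f)"
    if "perfect_matching G2 M" "M \<inter> C = {e}" for M e and h :: "'e \<Rightarrow> real"
    using split[OF that] fin(3) by (metis IntE finite_Int sum.insert)
  have in_le: "(\<Sum>e\<in>I. w e * x e) \<le> (\<Sum>e\<in>C. g (N e) * x e)"
  proof -
    \<comment> \<open>With these weights no perfect matching of \<open>G2\<close> weighs more than
      zero: it uses one cut edge \<open>e\<close> and gains at most \<open>g (N e)\<close> inside
      \<open>U\<close>. Hence the weight of \<open>x\<close> is at most zero too.\<close>
    define w2 where "w2 e = (if e \<in> C then - g (N e) else w e)" for e
    obtain M where M: "perfect_matching G2 M" "(\<Sum>e\<in>M. w2 e) \<ge> (\<Sum>e\<in>edges G2. w2 e * x e)"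
      using IH[OF c2 _ fr2, of w2] sub E2 by auto
    obtain e where e: "M \<inter> C = {e}" using cut2[OF M(1)] by auto
    have eC: "e \<in> C" "e \<in> M" using e by auto
    have "(\<Sum>f\<in>M \<inter> I. w2 f) = g M"
      unfolding g_def using disj by (intro sum.cong) (auto simp: w2_def)
    moreover have "g M \<le> g (N e)" using N(2)[OF eC(1)] M(1) eC by (auto simp: P_def)
    ultimately have "(\<Sum>e\<in>M. w2 e) \<le> 0" using sum2[OF M(1) e, of w2] eC by (simp add: w2_def)
    moreover have "(\<Sum>e\<in>edges G2. w2 e * x e) = (\<Sum>e\<in>C. w2 e * x e) + (\<Sum>e\<in>I. w2 e * x e)"
      unfolding E2 by (rule sum.union_disjoint) (use fin disj in auto)
    moreover have "(\<Sum>e\<in>C. w2 e * x e) = - (\<Sum>e\<in>C. g (N e) * x e)"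
      by (simp add: w2_def sum_negf)
    moreover have "(\<Sum>e\<in>I. w2 e * x e) = (\<Sum>e\<in>I. w e * x e)"
      using disj by (intro sum.cong) (auto simp: w2_def)
    ultimately show ?thesis using M(2) by linarith
  qed
  define w1 where "w1 e = w e + (if e \<in> C then g (N e) else 0)" for e
  obtain M1 where M1: "perfect_matching G1 M1" "(\<Sum>e\<in>M1. w1 e) \<ge> (\<Sum>e\<in>edges G1. w1 e * x e)"
    using IH[OF c1 _ fr1, of w1] sub E1 by auto
  obtain e where e: "M1 \<inter> C = {e}" using cut1[OF M1(1)] by auto
  have eC: "e \<in> C" "e \<in> M1" using e by auto
  have M1sub: "M1 \<subseteq> C \<union> Q" using M1(1) E1 by (auto simp: perfect_matching_def)
  have finM1: "finite M1" using M1sub fin by (meson finite_UnI finite_subset)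
  have NP: "perfect_matching G2 (N e)" "e \<in> N e" using N(1)[OF eC(1)] by (auto simp: P_def)
  obtain e' where "N e \<inter> C = {e'}" using cut2[OF NP(1)] by blast
  then have Ne: "N e \<inter> C = {e}" using NP(2) eC by auto
  have "perfect_matching G (M1 \<union> N e)"
    by (rule perfect_matching_glue[OF G U(1) u u'])
      (use M1(1) NP e Ne in \<open>auto simp: G1_def G2_def C_def\<close>)
  moreover have "(\<Sum>f\<in>M1 \<union> N e. w f) \<ge> (\<Sum>f\<in>edges G. w f * x f)"
  proof -
    have "insert e (N e \<inter> I) = N e" using split[OF NP(1) Ne] by (metis (no_types))
    moreover have "M1 \<union> insert e (N e \<inter> I) = M1 \<union> (N e \<inter> I)" using eC by blast
    ultimately have "M1 \<union> N e = M1 \<union> (N e \<inter> I)" by simp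
    then have "(\<Sum>f\<in>M1 \<union> N e. w f) = (\<Sum>f\<in>M1. w f) + g (N e)"
      unfolding g_def using M1sub disj fin finM1 by (simp, intro sum.union_disjoint) auto
    also have "\<dots> = (\<Sum>f\<in>M1. w1 f)"
    proof -
      have "(\<Sum>f\<in>M1. if f \<in> C then g (N f) else 0) = (\<Sum>f\<in>M1 \<inter> C. g (N f))"
        using finM1 by (simp add: sum.inter_restrict)
      then show ?thesis using e by (simp add: w1_def sum.distrib)
    qed
    also have "\<dots> \<ge> (\<Sum>f\<in>edges G1. w1 f * x f)" by (rule M1(2))
    also have "(\<Sum>f\<in>edges G1. w1 f * x f) = (\<Sum>f\<in>C \<union> Q. w f * x f) + (\<Sum>f\<in>C. g (N f) * x f)"
    proof -
      have "(\<Sum>f\<in>C \<union> Q. (if f \<in> C then g (N f) else 0) * x f) = (\<Sum>f\<in>(C \<union> Q) \<inter> C. g (N f) * x f)"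
        unfolding sum.inter_restrict[OF finite_UnI[OF fin(1,2)]] by (intro sum.cong) auto
      moreover have "(C \<union> Q) \<inter> C = C" by auto
      ultimately show ?thesis unfolding E1 by (simp add: w1_def sum.distrib distrib_right)
    qed
    finally have "(\<Sum>f\<in>C \<union> Q. w f * x f) + (\<Sum>f\<in>C. g (N f) * x f) \<le> (\<Sum>f\<in>M1 \<union> N e. w f)" .
    moreover have "(\<Sum>f\<in>edges G. w f * x f) = (\<Sum>f\<in>C \<union> Q. w f * x f) + (\<Sum>f\<in>I. w f * x f)"
      unfolding E by (rule sum.union_disjoint) (use fin disj in auto)
    ultimately show ?thesis using in_le by linarith
  qed
  ultimately show ?thesis by blast
qed

section \<open>Edmonds' perfect matching polytope theorem\<close>

text \<open>The ratio test of the simplex method: a pair \<open>(a, b)\<close> is a constraint whose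
  slack \<open>a\<close> changes at rate \<open>b\<close>, and \<open>t\<close> is the first time at
  which some slack vanishes.\<close>

lemma min_ratio:
  fixes J :: "(real \<times> real) set"
  assumes fin: "finite J" and pos: "\<And>a b. (a, b) \<in> J \<Longrightarrow> a > 0" and ex: "\<exists>(a, b)\<in>J. b < 0"
  shows "\<exists>t>0. (\<forall>(a, b)\<in>J. a + t * b \<ge> 0) \<and> (\<exists>(a, b)\<in>J. a + t * b = 0)"
proof -
  define R where "R = (\<lambda>(a, b). a / - b) ` {p \<in> J. snd p < 0}"
  have R: "finite R" "R \<noteq> {}" using fin ex by (auto simp: R_def)
  define t where "t = Min R"
  have tR: "t \<in> R" using R by (simp add: t_def)
  have le: "t \<le> a / - b" if "(a, b) \<in> J" "b < 0" for a b
    unfolding t_def using R(1) that by (intro Min_le) (auto simp: R_def)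
  obtain a b where ab: "(a, b) \<in> J" "b < 0" "t = a / - b" using tR by (auto simp: R_def)
  have "t > 0" unfolding ab(3) using ab(2) pos[OF ab(1)] by (intro divide_pos_pos) auto
  moreover have "a + t * b \<ge> 0" if "(a, b) \<in> J" for a b
  proof (cases "b < 0")
    case True
    then show ?thesis using le[OF that True] by (simp add: field_simps)
  next
    case False
    then show ?thesis using \<open>t > 0\<close> pos[OF that] by simp
  qed
  moreover have "a + t * b = 0" using ab by simp
  ultimately show ?thesis using ab(1) by blast
qed

definition nontriv :: "('v, 'e) mgraph \<Rightarrow> 'v set \<Rightarrow> bool" where
  "nontriv G S \<longleftrightarrow> S \<subseteq> verts G \<and> odd (card S) \<and> \<not> trivial_cut G S"

lemma trivial_cut_sum:
  assumes G: "graph G" and S: "S \<subseteq> verts G" "trivial_cut G S"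
  obtains v where "v \<in> verts G" "cut G S = cut G {v}"
proof (cases "card S = 1")
  case True
  then obtain v where "S = {v}" by (auto simp: card_1_singleton_iff)
  then show ?thesis using that S by auto
next
  case False
  then obtain v where v: "verts G - S = {v}" using S by (auto simp: trivial_cut_def card_1_singleton_iff)
  then have "cut G S = cut G {v}" using cut_compl[OF G S(1)] by simp
  then show ?thesis using that v by auto
qed

text \<open>Moving along \<open>f\<close> keeps all vertex equations, and the walk stops when an
  edge value or the excess of a nontrivial cut reaches zero. In Edmonds' theorem that obstacle
  drives the induction; in the dimension count it matters that a positive step stays
  feasible.\<close>

lemma perturb:
  fixes G :: "('v, 'e) mgraph"
  assumes x: "frac_pm G x" and f: "\<exists>e\<in>edges G. f e \<noteq> 0"
    and f0: "\<And>v. v \<in> verts G \<Longrightarrow> (\<Sum>e\<in>cut G {v}. f e) = 0"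
    and strict: "\<And>S. nontriv G S \<Longrightarrow> (\<Sum>e\<in>cut G S. x e) > 1"
  shows "\<exists>t>0. (\<forall>e\<in>edges G. x e + t * f e \<ge> 0) \<and>
    (\<forall>S. nontriv G S \<longrightarrow> (\<Sum>e\<in>cut G S. x e + t * f e) \<ge> 1) \<and>
    ((\<exists>e\<in>edges G. x e + t * f e = 0) \<or> (\<exists>S. nontriv G S \<and> (\<Sum>e\<in>cut G S. x e + t * f e) = 1))"
proof -
  note G = frac_pmD(1)[OF x]
  define J where "J = (\<lambda>e. (x e, f e)) ` edges G \<union>
    (\<lambda>S. ((\<Sum>e\<in>cut G S. x e) - 1, \<Sum>e\<in>cut G S. f e)) ` {S. nontriv G S}"
  have "finite {S. nontriv G S}"
    by (rule finite_subset[of _ "Pow (verts G)"]) (use G in \<open>auto simp: nontriv_def\<close>)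
  then have finJ: "finite J" using G by (simp add: J_def)
  have pos: "a > 0" if "(a, b) \<in> J" for a b
    using that frac_pmD(2)[OF x] strict by (auto simp: J_def)
  \<comment> \<open>Some value has to decrease, which bounds the step: a nonnegative
    \<open>f\<close> with zero sum at every vertex would vanish on all edges.\<close>
  have "\<exists>e\<in>edges G. f e < 0"
  proof (rule ccontr)
    assume "\<not> ?thesis"
    then have nn: "f e \<ge> 0" if "e \<in> edges G" for e using that by force
    obtain e where e: "e \<in> edges G" "f e \<noteq> 0" using f by blast
    obtain p q where pq: "ends G e = {p, q}" "p \<in> verts G" using ends_obtain[OF G e(1)] by metis
    have "f e = 0"
    proof (rule sum_nonneg_0[of "cut G {p}" f])
      show "finite (cut G {p})" using G by simp
      show "e \<in> cut G {p}" using e pq by (simp add: cut_singleton)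
      show "sum f (cut G {p}) = 0" using f0 pq by simp
      show "\<And>i. i \<in> cut G {p} \<Longrightarrow> 0 \<le> f i" using nn by (simp add: cut_singleton)
    qed
    then show False using e by simp
  qed
  then have "\<exists>(a, b)\<in>J. b < 0" by (force simp: J_def)
  from min_ratio[OF finJ _ this] pos obtain t where t: "t > 0"
    "\<forall>(a, b)\<in>J. a + t * b \<ge> 0" "\<exists>(a, b)\<in>J. a + t * b = 0" by blast
  have s: "(\<Sum>e\<in>cut G S. x e + t * f e) = (\<Sum>e\<in>cut G S. x e) + t * (\<Sum>e\<in>cut G S. f e)" for S
    by (simp add: sum.distrib sum_distrib_left)
  have "\<forall>e\<in>edges G. x e + t * f e \<ge> 0" using t(2) by (auto simp: J_def)
  moreover have "\<forall>S. nontriv G S \<longrightarrow> (\<Sum>e\<in>cut G S. x e + t * f e) \<ge> 1"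
    unfolding s using t(2) by (force simp: J_def)
  moreover have "(\<exists>e\<in>edges G. x e + t * f e = 0) \<or> (\<exists>S. nontriv G S \<and> (\<Sum>e\<in>cut G S. x e + t * f e) = 1)"
    unfolding s using t(3) unfolding J_def by auto
  ultimately show ?thesis using t(1) by blast
qed

text \<open>Edges of value zero contribute to no cut sum, so dropping them is harmless. Trivial odd
  cuts are stars of vertices and are settled by the vertex equations.\<close>

lemma frac_pm_support:
  assumes G: "graph G" and nn: "\<And>e. e \<in> edges G \<Longrightarrow> x e \<ge> 0"
    and v: "\<And>v. v \<in> verts G \<Longrightarrow> (\<Sum>e\<in>cut G {v}. x e) = 1"
    and S: "\<And>S. nontriv G S \<Longrightarrow> (\<Sum>e\<in>cut G S. x e) \<ge> 1"
  shows "frac_pm (G\<lparr>edges := {e \<in> edges G. x e > 0}\<rparr>) x"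
proof -
  let ?H = "G\<lparr>edges := {e \<in> edges G. x e > 0}\<rparr>"
  have eq: "(\<Sum>e\<in>cut ?H S. x e) = (\<Sum>e\<in>cut G S. x e)" for S
  proof (rule sum.mono_neutral_left)
    show "\<forall>i\<in>cut G S - cut ?H S. x i = 0" using nn by (force simp: cut_def)
  qed (use G in \<open>auto simp: cut_def\<close>)
  have S': "(\<Sum>e\<in>cut G S. x e) \<ge> 1" if st: "S \<subseteq> verts G" "odd (card S)" for S
  proof (cases "trivial_cut G S")
    case True
    then obtain u where "u \<in> verts G" "cut G S = cut G {u}" using trivial_cut_sum[OF G st(1) True] by metis
    then show ?thesis using v by simp
  next
    case False
    then show ?thesis using S st by (simp add: nontriv_def)
  qed
  have "graph ?H" using G unfolding graph_def by simp
  then show ?thesis unfolding frac_pm_def eq using v S' by simp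
qed

text \<open>If there are at most as many edges as vertices, all degrees are 2. Two parallel edges give \<open>f\<close>
  directly; otherwise a vertex \<open>b\<close> with neighbours \<open>a\<close> and \<open>c\<close> makes \<open>{a, b, c}\<close> tight, so
  the graph is a 4-cycle, where one of the vertex equations is redundant.\<close>
lemma exists_direction:
  fixes G :: "('v, 'e) mgraph"
  assumes x: "frac_pm G x" and ne: "verts G \<noteq> {}"
    and deg: "\<And>v. v \<in> verts G \<Longrightarrow> card (cut G {v}) \<noteq> 1"
    and strict: "\<And>S. nontriv G S \<Longrightarrow> (\<Sum>e\<in>cut G S. x e) > 1"
  shows "\<exists>f :: 'e \<Rightarrow> real. (\<exists>e\<in>edges G. f e \<noteq> 0) \<and> (\<forall>v\<in>verts G. (\<Sum>e\<in>cut G {v}. f e) = 0)"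
proof -
  note G = frac_pmD(1)[OF x]
  have finV: "finite (verts G)" and finE: "finite (edges G)" using G by auto
  have solve: "\<exists>f :: 'e \<Rightarrow> real. (\<exists>e\<in>edges G. f e \<noteq> 0) \<and> (\<forall>v\<in>S. (\<Sum>e\<in>cut G {v}. f e) = 0)"
    if "finite S" "card S < card (edges G)" for S
  proof -
    have "(\<Sum>e\<in>edges G. of_bool (v \<in> ends G e) * f e) = (\<Sum>e\<in>cut G {v}. f e)"
      for v and f :: "'e \<Rightarrow> real"
      using finE by (simp add: cut_singleton sum.inter_filter of_bool_def if_distribR if_distrib cong: if_cong)
    then show ?thesis
      using homogeneous_solution[OF that(1) finE that(2), of "\<lambda>v e. of_bool (v \<in> ends G e) :: real"]
      by simp
  qed
  show ?thesis
  proof (cases "card (verts G) < card (edges G)")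
    case True
    then show ?thesis using solve[OF finV] by blast
  next
    case False
    have ge2: "card (cut G {v}) \<ge> 2" if v: "v \<in> verts G" for v
    proof -
      have "cut G {v} \<noteq> {}" using frac_pmD(3)[OF x v] by auto
      then have "card (cut G {v}) \<noteq> 0" using G by simp
      then show ?thesis using deg[OF v] by linarith
    qed
    have degs: "(\<Sum>v\<in>verts G. card (cut G {v})) = 2 * card (edges G)"
      using sum_cut_singletons_verts[OF G, of "\<lambda>_. 1 :: nat"] by simp
    have eq2: "card (cut G {v}) = 2" if v: "v \<in> verts G" for v
    proof (rule ccontr)
      assume "card (cut G {v}) \<noteq> 2"
      then have "2 < card (cut G {v})" using ge2[OF v] by simp
      then have "(\<Sum>v\<in>verts G. 2) < (\<Sum>v\<in>verts G. card (cut G {v}))"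
        by (intro sum_strict_mono_ex1) (use finV ge2 v in auto)
      then show False using degs False by simp
    qed
    obtain b where b: "b \<in> verts G" using ne by blast
    obtain e1 e2 where e12: "cut G {b} = {e1, e2}" "e1 \<noteq> e2"
      using eq2[OF b] by (meson card_2_iff)
    have eE: "e1 \<in> edges G" "e2 \<in> edges G" "b \<in> ends G e1" "b \<in> ends G e2"
      using e12(1) by (auto simp: cut_singleton)
    obtain a where a: "ends G e1 = {b, a}" "a \<noteq> b" "a \<in> verts G"
      using other_end[OF G eE(1) eE(3)] by blast
    obtain c where c: "ends G e2 = {b, c}" "c \<noteq> b" "c \<in> verts G"
      using other_end[OF G eE(2) eE(4)] by blast
    have x12: "x e1 + x e2 = 1" using frac_pmD(3)[OF x b] e12 by simp
    show ?thesis
    proof (cases "a = c")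
      case True
      define f :: "'e \<Rightarrow> real" where "f e = of_bool (e = e1) - of_bool (e = e2)" for e
      have "(\<Sum>e\<in>cut G {v}. f e) = 0" for v
      proof -
        have "(\<Sum>e\<in>cut G {v}. of_bool (e = e')) = (of_bool (e' \<in> cut G {v}) :: real)" for e'
          using G by (simp add: of_bool_def sum.delta)
        moreover have "e1 \<in> cut G {v} \<longleftrightarrow> e2 \<in> cut G {v}"
          using eE a c True by (simp add: cut_singleton)
        ultimately show ?thesis by (simp add: f_def sum_subtractf)
      qed
      moreover have "f e1 \<noteq> 0" using e12 by (simp add: f_def)
      ultimately show ?thesis using eE by blast
    next
      case ac: False
      define U where "U = {a, b, c}"
      have U: "U \<subseteq> verts G" "card U = 3" using a b c ac by (auto simp: U_def)
      define I where "I = {e \<in> edges G. ends G e \<subseteq> U}"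
      have I12: "{e1, e2} \<subseteq> I" using a c eE by (auto simp: I_def U_def)
      have finI: "finite I" using finE by (simp add: I_def)
      have "(\<Sum>v\<in>U. \<Sum>e\<in>cut G {v}. x e) = (\<Sum>v\<in>U. 1)"
        using frac_pmD(3)[OF x] U(1) by (intro sum.cong) auto
      then have eq3: "(\<Sum>e\<in>cut G U. x e) + 2 * (\<Sum>e\<in>I. x e) = 3"
        using sum_cut_singletons_split[OF G U(1), of x] U(2) by (simp add: I_def)
      have pos: "x e > 0" if "e \<in> I" for e using that frac_pmD(2)[OF x] by (simp add: I_def)
      have "(\<Sum>e\<in>I. x e) = (\<Sum>e\<in>{e1, e2}. x e) + (\<Sum>e\<in>I - {e1, e2}. x e)"
        using sum.subset_diff[OF I12 finI, of x] by simp
      then have sI: "(\<Sum>e\<in>I. x e) = 1 + (\<Sum>e\<in>I - {e1, e2}. x e)" using e12 x12 by simp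
      have ge1: "(\<Sum>e\<in>cut G U. x e) \<ge> 1" using frac_pmD(4)[OF x U(1)] U(2) by simp
      have "(\<Sum>e\<in>I - {e1, e2}. x e) \<ge> 0" using pos by (intro sum_nonneg) (auto simp: less_imp_le)
      \<comment> \<open>The three vertex equations add up to 3, of which the two edges at
        \<open>b\<close>, counted from both ends, take 2. The odd cut takes at least 1, so nothing
        is left for further edges.\<close>
      then have cu: "(\<Sum>e\<in>cut G U. x e) = 1" "(\<Sum>e\<in>I - {e1, e2}. x e) = 0"
        using eq3 sI ge1 by linarith+
      have Ieq: "I = {e1, e2}"
      proof (rule ccontr)
        assume "I \<noteq> {e1, e2}"
        then have "(\<Sum>e\<in>I - {e1, e2}. x e) > 0" using finI I12 pos by (intro sum_pos) auto
        then show False using cu by simp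
      qed
      have "\<not> nontriv G U" using strict[of U] cu by auto
      then have "card (verts G - U) = 1" using U by (auto simp: nontriv_def trivial_cut_def)
      then obtain d where d: "verts G - U = {d}" by (auto simp: card_1_singleton_iff)
      have V: "verts G = {a, b, c, d}" "d \<notin> {a, b, c}" using d U(1) by (auto simp: U_def)
      have "(\<Sum>v\<in>verts G. card (cut G {v})) = (\<Sum>v\<in>verts G. 2)"
        by (rule sum.cong) (use eq2 in auto)
      moreover have "card (verts G) = 4" using V a c ac by (auto simp: card_insert_if)
      ultimately have "card U < card (edges G)" using degs U(2) by simp
      moreover have "finite U" by (simp add: U_def)
      ultimately obtain f :: "'e \<Rightarrow> real" where f: "\<exists>e\<in>edges G. f e \<noteq> 0" "\<forall>v\<in>U. (\<Sum>e\<in>cut G {v}. f e) = 0"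
        using solve[of U] by blast
      \<comment> \<open>The equations at \<open>a\<close> and \<open>c\<close> together count each
        edge once, so \<open>f\<close> has total zero, and the equation at \<open>d\<close> follows
        from the other three.\<close>
      have one: "card (ends G e \<inter> {a, c}) = 1" if e: "e \<in> edges G" for e
      proof (cases "e \<in> I")
        case True
        then consider "e = e1" | "e = e2" using Ieq by blast
        then show ?thesis
        proof cases
          case 1
          show ?thesis unfolding 1 a(1) card_inter_pair[OF a(2)[symmetric]] using a(2) c(2) by simp
        next
          case 2
          show ?thesis unfolding 2 c(1) card_inter_pair[OF c(2)[symmetric]] using a(2) c(2) by simp
        qed
      next
        case False
        obtain p q where pq: "ends G e = {p, q}" "p \<noteq> q" "p \<in> verts G" "q \<in> verts G"
          using ends_obtain[OF G e] by metis
        have "b \<notin> ends G e" using e12(1) e Ieq False by (auto simp: cut_singleton)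
        moreover have "d \<in> ends G e" using False e pq V by (auto simp: I_def U_def)
        ultimately show ?thesis unfolding pq(1) card_inter_pair[OF pq(2)] using pq(2-4) V by auto
      qed
      have "(\<Sum>v\<in>{a, c}. \<Sum>e\<in>cut G {v}. f e) = (\<Sum>e\<in>edges G. of_nat (card (ends G e \<inter> {a, c})) * f e)"
        by (rule sum_cut_singletons[OF G]) (use V in auto)
      also have "\<dots> = (\<Sum>e\<in>edges G. f e)" by (rule sum.cong) (use one in auto)
      finally have "(\<Sum>e\<in>edges G. f e) = 0" using f(2) ac by (simp add: U_def)
      then have "(\<Sum>v\<in>verts G. \<Sum>e\<in>cut G {v}. f e) = 0" using sum_cut_singletons_verts[OF G, of f] by simp
      moreover have "verts G = insert d U" "d \<notin> U" "finite U" using V by (auto simp: U_def)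
      ultimately have "(\<Sum>e\<in>cut G {d}. f e) = 0" using f(2) by simp
      then have "\<forall>v\<in>verts G. (\<Sum>e\<in>cut G {v}. f e) = 0" using f(2) \<open>verts G = insert d U\<close> by auto
      then show ?thesis using f(1) by blast
    qed
  qed
qed

lemma perfect_matching_subgraph:
  "perfect_matching (G\<lparr>edges := E\<rparr>) M \<Longrightarrow> E \<subseteq> edges G \<Longrightarrow> perfect_matching G M"
  by (auto simp: perfect_matching_def)

text \<open>If \<open>x\<close> were no convex combination of perfect matchings, a linear functional
  would separate it from them; the weighted form says that no \<open>w\<close> does. The walk inside
  the polytope ends at a smaller instance: a deleted edge or a tight nontrivial cut.\<close>

theorem edmonds:
  fixes G :: "('v, 'e) mgraph"
  assumes "frac_pm G x"
  shows "\<exists>M. perfect_matching G M \<and> (\<Sum>e\<in>M. w e) \<ge> (\<Sum>e\<in>edges G. w e * x e)"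
  using assms
proof (induction "card (verts G) + card (edges G)" arbitrary: G x w rule: less_induct)
  case less
  note x = less.prems
  note G = frac_pmD(1)[OF x]
  have finV: "finite (verts G)" and finE: "finite (edges G)" using G by auto
  have glue: "\<exists>M. perfect_matching G M \<and> (\<Sum>e\<in>M. w e) \<ge> (\<Sum>e\<in>edges G. w e * y e)"
    if "frac_pm G y" "nontriv G U" "(\<Sum>e\<in>cut G U. y e) = 1" for y U
  proof (rule edmonds_glue[OF that(1) _ _ _ _ that(3)])
    fix G' :: "('v, 'e) mgraph" and w'
    assume "card (verts G') < card (verts G)" "edges G' \<subseteq> edges G" "frac_pm G' y"
    then show "\<exists>M. perfect_matching G' M \<and> (\<Sum>e\<in>edges G'. w' e * y e) \<le> sum w' M"
      using less.hyps[of G' y w'] card_mono[OF finE, of "edges G'"] by auto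
  qed (use that(2) in \<open>auto simp: nontriv_def trivial_cut_def\<close>)
  consider "verts G = {}" | v where "v \<in> verts G" "card (cut G {v}) = 1"
    | U where "nontriv G U" "(\<Sum>e\<in>cut G U. x e) = 1"
    | "verts G \<noteq> {}" "\<And>v. v \<in> verts G \<Longrightarrow> card (cut G {v}) \<noteq> 1"
      "\<And>S. nontriv G S \<Longrightarrow> (\<Sum>e\<in>cut G S. x e) > 1"
    using frac_pmD(4)[OF x] unfolding nontriv_def by (metis less_eq_real_def)
  then show ?case
  proof cases
    case 1
    then have "edges G = {}" using G by (auto simp: graph_def)
    then show ?thesis using 1 by (intro exI[of _ "{}"]) (simp add: perfect_matching_def)
  next
    \<comment> \<open>The only edge \<open>e\<close> at \<open>v\<close> has value 1, and positivity
      leaves no other edge at its second end \<open>u\<close>. So \<open>e\<close> with its ends is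
      a component and can be removed.\<close>
    case (2 v)
    then obtain e where e: "cut G {v} = {e}" by (auto simp: card_1_singleton_iff)
    then have eE: "e \<in> edges G" "v \<in> ends G e" by (auto simp: cut_singleton)
    obtain u where u: "ends G e = {v, u}" "u \<noteq> v" "u \<in> verts G"
      using other_end[OF G eE] by blast
    have xe: "x e = 1" using frac_pmD(3)[OF x 2(1)] e by simp
    have eu: "e \<in> cut G {u}" using eE u by (simp add: cut_singleton)
    have "(\<Sum>f\<in>cut G {u}. x f) = x e + (\<Sum>f\<in>cut G {u} - {e}. x f)"
      using G eu by (simp add: sum.remove)
    then have "(\<Sum>f\<in>cut G {u} - {e}. x f) = 0" using frac_pmD(3)[OF x u(3)] xe by simp
    moreover have "(\<Sum>f\<in>cut G {u} - {e}. x f) > 0" if "cut G {u} - {e} \<noteq> {}"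
      using that G frac_pmD(2)[OF x] by (intro sum_pos) (auto simp: cut_singleton)
    ultimately have cu: "cut G {u} = {e}" using eu by auto
    define H where "H = G\<lparr>verts := verts G - {v, u}, edges := edges G - {e}\<rparr>"
    have avoid: "v \<notin> ends G f" "u \<notin> ends G f" if "f \<in> edges H" for f
      using that e cu by (auto simp: H_def cut_singleton)
    have cutH: "cut H S = cut G S" if "S \<subseteq> verts H" for S
    proof -
      have "ends G e \<inter> S = {}" using that u by (auto simp: H_def)
      then show ?thesis by (auto simp: cut_def H_def)
    qed
    have "graph H" using G avoid unfolding graph_def H_def by auto
    moreover have "verts H \<subseteq> verts G" by (auto simp: H_def)
    ultimately have frH: "frac_pm H x"
      unfolding frac_pm_def
    proof (intro conjI ballI allI impI)
      fix f assume "f \<in> edges H"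
      then show "x f > 0" using frac_pmD(2)[OF x] by (simp add: H_def)
    next
      fix z assume "verts H \<subseteq> verts G" "z \<in> verts H"
      then show "(\<Sum>f\<in>cut H {z}. x f) = 1"
        using cutH[of "{z}"] frac_pmD(3)[OF x, of z] by auto
    next
      fix S assume "verts H \<subseteq> verts G" "S \<subseteq> verts H" "odd (card S)"
      then show "(\<Sum>f\<in>cut H S. x f) \<ge> 1"
        using cutH[of S] frac_pmD(4)[OF x, of S] by auto
    qed
    have "edges H \<subset> edges G" "verts H \<subset> verts G" using eE 2 by (auto simp: H_def)
    then have "card (verts H) < card (verts G)" "card (edges H) < card (edges G)"
      using finV finE by (simp_all add: psubset_card_mono)
    then obtain M where M: "perfect_matching H M" "(\<Sum>f\<in>M. w f) \<ge> (\<Sum>f\<in>edges H. w f * x f)"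
      using less.hyps[OF _ frH, of w] by auto
    have ME: "M \<subseteq> edges H" using M(1) by (simp add: perfect_matching_def)
    have finM: "finite M" using ME finE finite_subset by (fastforce simp: H_def)
    have eM: "e \<notin> M" using ME by (auto simp: H_def)
    have "perfect_matching G (insert e M)"
      unfolding perfect_matching_def
    proof (intro conjI ballI)
      show "insert e M \<subseteq> edges G" using ME eE by (auto simp: H_def)
      fix z assume z: "z \<in> verts G"
      show "\<exists>!f. f \<in> insert e M \<and> z \<in> ends G f"
      proof (cases "z \<in> {v, u}")
        case True
        then show ?thesis using u avoid ME by (intro ex1I[of _ e]) auto
      next
        case False
        then have "z \<in> verts H" "z \<notin> ends G e" using z u by (auto simp: H_def)
        then have "\<exists>!f. f \<in> M \<and> z \<in> ends G f"
          using M(1) by (simp add: perfect_matching_def H_def)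
        then show ?thesis using \<open>z \<notin> ends G e\<close> by (metis insert_iff)
      qed
    qed
    moreover have "(\<Sum>f\<in>edges G. w f * x f) = w e + (\<Sum>f\<in>edges H. w f * x f)"
      using finE eE xe by (simp add: H_def sum.remove)
    ultimately show ?thesis using M(2) finM eM by (intro exI[of _ "insert e M"]) simp
  next
    case (3 U)
    then show ?thesis using glue[OF x] by blast
  next
    case 4
    obtain f0 :: "'e \<Rightarrow> real" where f0: "\<exists>e\<in>edges G. f0 e \<noteq> 0"
      "\<forall>v\<in>verts G. (\<Sum>e\<in>cut G {v}. f0 e) = 0"
      using exists_direction[OF x 4] by blast
    \<comment> \<open>Both \<open>f0\<close> and its negative respect the vertex equations; the sign
      is chosen so that the move does not lower the weight.\<close>
    define f where "f = (if (\<Sum>e\<in>edges G. w e * f0 e) \<ge> 0 then f0 else (\<lambda>e. - f0 e))"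
    have f: "\<exists>e\<in>edges G. f e \<noteq> 0" "\<And>v. v \<in> verts G \<Longrightarrow> (\<Sum>e\<in>cut G {v}. f e) = 0"
      "(\<Sum>e\<in>edges G. w e * f e) \<ge> 0"
      using f0 by (auto simp: f_def sum_negf)
    obtain t where t: "t > 0" "\<forall>e\<in>edges G. x e + t * f e \<ge> 0"
      "\<forall>S. nontriv G S \<longrightarrow> (\<Sum>e\<in>cut G S. x e + t * f e) \<ge> 1"
      "(\<exists>e\<in>edges G. x e + t * f e = 0) \<or> (\<exists>S. nontriv G S \<and> (\<Sum>e\<in>cut G S. x e + t * f e) = 1)"
      using perturb[OF x f(1,2) 4(3)] by blast
    define y where "y e = x e + t * f e" for e
    define H where "H = G\<lparr>edges := {e \<in> edges G. y e > 0}\<rparr>"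
    have yv: "(\<Sum>e\<in>cut G {v}. y e) = 1" if "v \<in> verts G" for v
      using frac_pmD(3)[OF x that] f(2)[OF that]
      by (simp add: y_def sum.distrib sum_distrib_left[symmetric])
    have frH: "frac_pm H y"
      unfolding H_def by (rule frac_pm_support[OF G _ yv]) (use t in \<open>auto simp: y_def\<close>)
    have wy: "(\<Sum>e\<in>edges G. w e * x e) \<le> (\<Sum>e\<in>edges G. w e * y e)"
    proof -
      have "(\<Sum>e\<in>edges G. w e * y e) = (\<Sum>e\<in>edges G. w e * x e) + t * (\<Sum>e\<in>edges G. w e * f e)"
        by (simp add: y_def sum.distrib sum_distrib_left algebra_simps)
      then show ?thesis using f(3) t(1) by simp
    qed
    show ?thesis
    \<comment> \<open>If an edge reaches zero, the graph gets smaller. Otherwise it is unchanged,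
      but a nontrivial cut has become tight for \<open>y\<close>, so gluing applies.\<close>
    proof (cases "\<exists>e\<in>edges G. y e = 0")
      case True
      then obtain e where "e \<in> edges G" "e \<notin> edges H" by (auto simp: H_def)
      moreover have "edges H \<subseteq> edges G" by (auto simp: H_def)
      ultimately have "edges H \<subset> edges G" by blast
      then have "card (edges H) < card (edges G)" using finE by (rule psubset_card_mono[rotated])
      moreover have "card (verts H) = card (verts G)" by (simp add: H_def)
      ultimately obtain M where M: "perfect_matching H M" "(\<Sum>e\<in>M. w e) \<ge> (\<Sum>e\<in>edges H. w e * y e)"
        using less.hyps[OF _ frH, of w] by auto
      have "(\<Sum>e\<in>edges H. w e * y e) = (\<Sum>e\<in>edges G. w e * y e)"
        using finE t(2) by (intro sum.mono_neutral_left) (force simp: H_def y_def)+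
      then show ?thesis using M wy perfect_matching_subgraph[where G = G and E = "edges H" and M = M]
        by (force simp: H_def)
    next
      case False
      then have "y e > 0" if "e \<in> edges G" for e using t(2) that by (force simp: y_def)
      then have "H = G" by (auto simp: H_def intro!: mgraph.equality)
      moreover obtain U where "nontriv G U" "(\<Sum>e\<in>cut G U. y e) = 1"
        using t(4) False by (auto simp: y_def)
      ultimately show ?thesis using glue[of y U] frH wy by (metis order.trans)
    qed
  qed
qed

section \<open>Counting perfect matchings\<close>

definition mult :: "('v, 'e) mgraph \<Rightarrow> 'v \<Rightarrow> 'v \<Rightarrow> nat" where
  "mult G u v = card {e \<in> edges G. ends G e = {u, v}}"

lemma mult_commute: "mult G u v = mult G v u"
  by (simp add: mult_def insert_commute)

lemma mult_self:
  assumes "graph G" shows "mult G v v = 0"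
proof -
  have "ends G e \<noteq> {v, v}" if "e \<in> edges G" for e
    using graph_ends(2)[OF assms that] by auto
  then have "{e \<in> edges G. ends G e = {v, v}} = {}" by blast
  then show ?thesis unfolding mult_def by (simp only: card.empty)
qed

lemma mult_pos_iff:
  "graph G \<Longrightarrow> mult G u v > 0 \<longleftrightarrow> (\<exists>e\<in>edges G. ends G e = {u, v})"
  by (auto simp: mult_def card_gt_0_iff)

text \<open>Vertex sets in place of induced subgraphs let the recursion delete the ends of an edge
  while the graph stays fixed.\<close>

definition matchings_on :: "('v, 'e) mgraph \<Rightarrow> 'v set \<Rightarrow> 'e set set" where
  "matchings_on G W = {M. M \<subseteq> edges G \<and> (\<forall>e\<in>M. ends G e \<subseteq> W) \<and>
     (\<forall>v\<in>W. \<exists>!e. e \<in> M \<and> v \<in> ends G e)}"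

lemma perfect_matching_iff_matchings_on:
  "graph G \<Longrightarrow> perfect_matching G M \<longleftrightarrow> M \<in> matchings_on G (verts G)"
  unfolding perfect_matching_def matchings_on_def graph_def by blast

lemma finite_matchings_on: "graph G \<Longrightarrow> finite (matchings_on G W)"
  by (rule finite_subset[of _ "Pow (edges G)"]) (auto simp: matchings_on_def)

lemma matchings_on_empty:
  assumes "graph G" shows "matchings_on G {} = {{}}"
  unfolding matchings_on_def using graph_ends(2)[OF assms] by fastforce

lemma card_matchings_on_edge:
  assumes G: "graph G" and e: "e \<in> edges G" "ends G e \<subseteq> W"
  shows "card {M \<in> matchings_on G W. e \<in> M} = card (matchings_on G (W - ends G e))"
proof (rule bij_betw_same_card[of "\<lambda>M. M - {e}"], rule bij_betw_byWitness[where f' = "insert e"])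
  have ne: "ends G f \<noteq> {}" if "f \<in> edges G" for f
    using graph_ends(2)[OF G that] by auto
  show "\<forall>a\<in>{M \<in> matchings_on G W. e \<in> M}. insert e (a - {e}) = a" by auto
  show "\<forall>a'\<in>matchings_on G (W - ends G e). insert e a' - {e} = a'"
    using ne[OF e(1)] by (auto simp: matchings_on_def)
  show "(\<lambda>M. M - {e}) ` {M \<in> matchings_on G W. e \<in> M} \<subseteq> matchings_on G (W - ends G e)"
  proof clarify
    fix M assume M: "M \<in> matchings_on G W" "e \<in> M"
    have "ends G f \<inter> ends G e = {}" if "f \<in> M - {e}" for f
      using M that unfolding matchings_on_def by blast
    then show "M - {e} \<in> matchings_on G (W - ends G e)"
      using M unfolding matchings_on_def by blast
  qed
  show "insert e ` matchings_on G (W - ends G e) \<subseteq> {M \<in> matchings_on G W. e \<in> M}"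
  proof clarify
    fix M assume M: "M \<in> matchings_on G (W - ends G e)"
    have "\<exists>!f. f \<in> insert e M \<and> v \<in> ends G f" if "v \<in> W" for v
    proof (cases "v \<in> ends G e")
      case True
      then show ?thesis using M unfolding matchings_on_def by blast
    next
      case False
      then have "\<exists>!f. f \<in> M \<and> v \<in> ends G f" using M that unfolding matchings_on_def by blast
      then show ?thesis using False by blast
    qed
    then show "insert e M \<in> matchings_on G W \<and> e \<in> insert e M"
      using M e unfolding matchings_on_def by blast
  qed
qed

text \<open>The matchings are sorted by the edge that covers \<open>v\<close>; all parallel edges to
  the same \<open>u\<close> leave the same rest.\<close>

lemma card_matchings_on_rec:
  assumes G: "graph G" and W: "finite W" "v \<in> W"
  shows "card (matchings_on G W) = (\<Sum>u\<in>W - {v}. mult G v u * card (matchings_on G (W - {v, u})))"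
proof -
  define D where "D u = {e \<in> edges G. ends G e = {v, u}}" for u
  have "matchings_on G W = (\<Union>u\<in>W - {v}. \<Union>e\<in>D u. {M \<in> matchings_on G W. e \<in> M})" (is "_ = ?R")
  proof
    show "matchings_on G W \<subseteq> ?R"
    proof
      fix M assume M: "M \<in> matchings_on G W"
      then obtain e where e: "e \<in> M" "v \<in> ends G e" using W unfolding matchings_on_def by blast
      then have eE: "e \<in> edges G" "ends G e \<subseteq> W" using M unfolding matchings_on_def by blast+
      obtain u where "ends G e = {v, u}" "u \<noteq> v" using other_end[OF G eE(1) e(2)] by blast
      then show "M \<in> ?R" using eE e M by (auto simp: D_def)
    qed
  qed auto
  then have "card (matchings_on G W) = card ?R" by simp
  also have "\<dots> = (\<Sum>u\<in>W - {v}. card (\<Union>e\<in>D u. {M \<in> matchings_on G W. e \<in> M}))"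
  proof (rule card_UN_disjoint)
    show "finite (W - {v})" using W by simp
    show "\<forall>i\<in>W - {v}. finite (\<Union>e\<in>D i. {M \<in> matchings_on G W. e \<in> M})"
      using finite_matchings_on[OF G, of W] G by (simp add: D_def)
    have "e = f" if "M \<in> matchings_on G W" "e \<in> M" "f \<in> M" "v \<in> ends G e" "v \<in> ends G f" for M e f
      using that W unfolding matchings_on_def by blast
    moreover have "v \<in> ends G e" if "e \<in> D u" for e u using that by (simp add: D_def)
    moreover have "i = j" if "e \<in> D i" "e \<in> D j" "i \<noteq> v" "j \<noteq> v" for e i j
      using that by (auto simp: D_def doubleton_eq_iff)
    ultimately show "\<forall>i\<in>W - {v}. \<forall>j\<in>W - {v}. i \<noteq> j \<longrightarrow>
        (\<Union>e\<in>D i. {M \<in> matchings_on G W. e \<in> M}) \<inter> (\<Union>e\<in>D j. {M \<in> matchings_on G W. e \<in> M}) = {}"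
      by blast
  qed
  also have "\<dots> = (\<Sum>u\<in>W - {v}. mult G v u * card (matchings_on G (W - {v, u})))"
  proof (rule sum.cong[OF refl])
    fix u assume u: "u \<in> W - {v}"
    have "card (\<Union>e\<in>D u. {M \<in> matchings_on G W. e \<in> M}) =
      (\<Sum>e\<in>D u. card {M \<in> matchings_on G W. e \<in> M})"
    proof (rule card_UN_disjoint)
      show "finite (D u)" using G by (simp add: D_def)
      show "\<forall>i\<in>D u. finite {M \<in> matchings_on G W. i \<in> M}"
        using finite_matchings_on[OF G, of W] by simp
      show "\<forall>i\<in>D u. \<forall>j\<in>D u. i \<noteq> j \<longrightarrow>
        {M \<in> matchings_on G W. i \<in> M} \<inter> {M \<in> matchings_on G W. j \<in> M} = {}"
        using W(2) unfolding D_def matchings_on_def by blast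
    qed
    also have "\<dots> = (\<Sum>e\<in>D u. card (matchings_on G (W - {v, u})))"
    proof (rule sum.cong[OF refl])
      fix e assume "e \<in> D u"
      then have "e \<in> edges G" "ends G e = {v, u}" by (auto simp: D_def)
      then show "card {M \<in> matchings_on G W. e \<in> M} = card (matchings_on G (W - {v, u}))"
        using card_matchings_on_edge[OF G, of e W] u W by simp
    qed
    also have "\<dots> = mult G v u * card (matchings_on G (W - {v, u}))" by (simp add: mult_def D_def)
    finally show "card (\<Union>e\<in>D u. {M \<in> matchings_on G W. e \<in> M}) =
      mult G v u * card (matchings_on G (W - {v, u}))" .
  qed
  finally show ?thesis .
qed

text \<open>For symmetric \<open>m\<close> and a distinct list this is the hafnian of
  \<open>m\<close> on the list, expanded along the first row. Lists make it executable.\<close>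

function (sequential) matching_count :: "('v \<Rightarrow> 'v \<Rightarrow> nat) \<Rightarrow> 'v list \<Rightarrow> nat" where
  "matching_count m [] = 1"
| "matching_count m (v # vs) = (\<Sum>u\<leftarrow>vs. m v u * matching_count m (remove1 u vs))"
  by pat_completeness auto
termination by (relation "measure (\<lambda>(m, vs). length vs)") (auto simp: length_remove1)

lemma card_matchings_on_pmc:
  assumes G: "graph G" and "distinct vs"
  shows "card (matchings_on G (set vs)) = matching_count (mult G) vs"
  using assms(2)
proof (induction "mult G" vs rule: matching_count.induct)
  case 1
  then show ?case using matchings_on_empty[OF G] by simp
next
  case (2 v vs)
  have "card (matchings_on G (set (v # vs))) =
    (\<Sum>u\<in>set (v # vs) - {v}. mult G v u * card (matchings_on G (set (v # vs) - {v, u})))"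
    by (rule card_matchings_on_rec[OF G]) auto
  also have "set (v # vs) - {v} = set vs" using 2(2) by auto
  also have "(\<Sum>u\<in>set vs. mult G v u * card (matchings_on G (set (v # vs) - {v, u}))) =
    (\<Sum>u\<in>set vs. mult G v u * matching_count (mult G) (remove1 u vs))"
  proof (rule sum.cong[OF refl])
    fix u assume u: "u \<in> set vs"
    have "set (v # vs) - {v, u} = set (remove1 u vs)" using 2(2) by auto
    then show "mult G v u * card (matchings_on G (set (v # vs) - {v, u})) =
      mult G v u * matching_count (mult G) (remove1 u vs)" using 2(1)[OF u] 2(2) by simp
  qed
  also have "\<dots> = matching_count (mult G) (v # vs)"
    using 2(2) by (simp add: sum_list_distinct_conv_sum_set)
  finally show ?case .
qed

lemma card_perfect_matchings_edge:
  assumes G: "graph G" and e: "e \<in> edges G" "ends G e = {u, v}"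
    and vs: "distinct vs" "set vs = verts G - {u, v}"
  shows "card {M. perfect_matching G M \<and> e \<in> M} = matching_count (mult G) vs"
  using card_matchings_on_edge[OF G e(1) graph_ends(1)[OF G e(1)]] card_matchings_on_pmc[OF G vs(1)] vs e
  by (simp add: perfect_matching_iff_matchings_on[OF G])

lemma card_cut_mult:
  assumes G: "graph G" and S: "S \<subseteq> verts G"
  shows "card (cut G S) = (\<Sum>u\<in>S. \<Sum>v\<in>verts G - S. mult G u v)"
proof -
  have fin: "finite S" "finite (verts G - S)" using G S finite_subset[of S "verts G"] by auto
  have "cut G S = (\<Union>p\<in>S \<times> (verts G - S). {e \<in> edges G. ends G e = {fst p, snd p}})" (is "_ = ?R")
  proof
    show "cut G S \<subseteq> ?R"
    proof
      fix e assume "e \<in> cut G S"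
      then have e: "e \<in> edges G" "card (ends G e \<inter> S) = 1" by (auto simp: cut_def)
      then obtain u where "u \<in> ends G e" "u \<in> S" by (metis Int_iff card_1_singletonE singletonI)
      moreover obtain v where v: "ends G e = {u, v}" "u \<noteq> v" "v \<in> verts G"
        using other_end[OF G e(1) \<open>u \<in> ends G e\<close>] by metis
      ultimately have "v \<notin> S" using e(2) unfolding v(1) card_inter_pair[OF v(2)] by auto
      then show "e \<in> ?R" using e v \<open>u \<in> S\<close> by auto
    qed
    show "?R \<subseteq> cut G S" by (auto simp: cut_def Int_insert_left)
  qed
  then have "card (cut G S) = card ?R" by simp
  also have "\<dots> = (\<Sum>p\<in>S \<times> (verts G - S). card {e \<in> edges G. ends G e = {fst p, snd p}})"
  proof (rule card_UN_disjoint)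
    show "finite (S \<times> (verts G - S))" using fin by simp
    show "\<forall>i\<in>S \<times> (verts G - S). finite {e \<in> edges G. ends G e = {fst i, snd i}}" using G by simp
    show "\<forall>i\<in>S \<times> (verts G - S). \<forall>j\<in>S \<times> (verts G - S). i \<noteq> j \<longrightarrow>
       {e \<in> edges G. ends G e = {fst i, snd i}} \<inter> {e \<in> edges G. ends G e = {fst j, snd j}} = {}"
      by (force simp: doubleton_eq_iff)
  qed
  also have "\<dots> = (\<Sum>u\<in>S. \<Sum>v\<in>verts G - S. mult G u v)"
    by (simp add: mult_def sum.cartesian_product split_beta)
  finally show ?thesis .
qed

lemma card_cut_singleton_mult:
  assumes "graph G" "v \<in> verts G"
  shows "card (cut G {v}) = (\<Sum>u\<in>verts G. mult G v u)"
  using card_cut_mult[of G "{v}"] assms by (simp add: sum.remove[of "verts G" v] mult_self)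

lemma perfect_matching_card_cut_singleton:
  "perfect_matching G M \<Longrightarrow> v \<in> verts G \<Longrightarrow> card (M \<inter> cut G {v}) = 1"
  using perfect_matching_cut_singleton[of G M v] by force

text \<open>Each vertex of \<open>S\<close> lies on one matching edge, and the matching edges inside
  \<open>S\<close> use up its vertices in pairs.\<close>

lemma perfect_matching_odd_cut:
  assumes G: "graph G" and M: "perfect_matching G M" and S: "S \<subseteq> verts G" "odd (card S)"
  shows "odd (card (M \<inter> cut G S))"
proof -
  have eq: "(\<Sum>e\<in>cut G T. of_bool (e \<in> M)) = card (M \<inter> cut G T)" for T
    using G by (simp add: of_bool_def sum.inter_filter[symmetric] Int_def conj_commute)
  have "(\<Sum>v\<in>S. \<Sum>e\<in>cut G {v}. of_bool (e \<in> M)) = (\<Sum>v\<in>S. 1::nat)"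
    unfolding eq using perfect_matching_card_cut_singleton[OF M] S(1) by (intro sum.cong) auto
  then have "card S = card (M \<inter> cut G S) + 2 * (\<Sum>e\<in>{e \<in> edges G. ends G e \<subseteq> S}. of_bool (e \<in> M))"
    using sum_cut_singletons_split[OF G S(1), of "\<lambda>e. of_bool (e \<in> M) :: nat"] unfolding eq by simp
  then show ?thesis using S(2) by presburger
qed

lemma perfect_matching_even:
  assumes "graph G" "perfect_matching G M"
  shows "even (card (verts G))"
  using perfect_matching_odd_cut[OF assms order.refl] cut_verts[OF assms(1)] by auto

section \<open>Double counting over the perfect matchings of a double covered graph\<close>

context
  fixes G :: "('v, 'e) mgraph"
  assumes dc: "matching_double_covered G"
begin

private lemma G: "graph G" using dc by (simp add: matching_double_covered_def connected_graph_def)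

private lemma fin: "finite {M. perfect_matching G M}"
  by (rule finite_subset[of _ "Pow (edges G)"]) (use G in \<open>auto simp: perfect_matching_def\<close>)

lemma double_covered_sum:
  fixes h :: "'e \<Rightarrow> 'a::comm_semiring_1"
  assumes "C \<subseteq> edges G"
  shows "(\<Sum>M\<in>{M. perfect_matching G M}. \<Sum>e\<in>M \<inter> C. h e) = 2 * (\<Sum>e\<in>C. h e)"
proof -
  have finC: "finite C" using assms G by (metis finite_subset graph_finite(2))
  have "(\<Sum>M\<in>{M. perfect_matching G M}. \<Sum>e\<in>M \<inter> C. h e) =
    (\<Sum>M\<in>{M. perfect_matching G M}. \<Sum>e\<in>C. if e \<in> M then h e else 0)"
    by (rule sum.cong[OF refl]) (simp only: sum.inter_restrict[OF finC] Int_commute[of _ C])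
  also have "\<dots> = (\<Sum>e\<in>C. \<Sum>M\<in>{M. perfect_matching G M}. if e \<in> M then h e else 0)"
    by (rule sum.swap)
  also have "\<dots> = (\<Sum>e\<in>C. 2 * h e)"
  proof (rule sum.cong[OF refl])
    fix e assume "e \<in> C"
    then have "card {M. perfect_matching G M \<and> e \<in> M} = 2"
      using assms dc by (auto simp: matching_double_covered_def)
    moreover have "(\<Sum>M\<in>{M. perfect_matching G M}. if e \<in> M then h e else 0) =
      (\<Sum>M\<in>{M \<in> {M. perfect_matching G M}. e \<in> M}. h e)"
      by (rule sum.inter_filter[OF fin, symmetric])
    ultimately show "(\<Sum>M\<in>{M. perfect_matching G M}. if e \<in> M then h e else 0) = 2 * h e"
      by simp
  qed
  finally show ?thesis by (simp add: sum_distrib_left)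
qed

lemma double_covered_card:
  assumes "C \<subseteq> edges G"
  shows "(\<Sum>M\<in>{M. perfect_matching G M}. card (M \<inter> C)) = 2 * card C"
  using double_covered_sum[OF assms, of "\<lambda>_. 1 :: nat"] by simp

lemma double_covered_regular:
  assumes "v \<in> verts G"
  shows "card {M. perfect_matching G M} = 2 * card (cut G {v})"
proof -
  have "(\<Sum>M\<in>{M. perfect_matching G M}. card (M \<inter> cut G {v})) = (\<Sum>M\<in>{M. perfect_matching G M}. 1)"
    using perfect_matching_card_cut_singleton[OF _ assms] by (intro sum.cong) auto
  then show ?thesis using double_covered_card[of "cut G {v}"] by (simp add: cut_def)
qed

text \<open>Summed over all perfect matchings, the intersections with the cut total
  \<open>2 * card (cut G S)\<close>. By parity each is at least 1, and a matching that witnesses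
  nontightness contributes at least 3.\<close>

lemma double_covered_nontriv_cut:
  assumes br: "brick G" and S: "nontriv G S"
  shows "2 * card (cut G S) \<ge> card {M. perfect_matching G M} + 2"
proof -
  have S': "S \<subseteq> verts G" "odd (card S)" using S by (auto simp: nontriv_def)
  have odd: "odd (card (M \<inter> cut G S))" if "perfect_matching G M" for M
    using perfect_matching_odd_cut[OF G that S'] .
  have "\<not> tight_cut G S" using br S by (auto simp: brick_def nontriv_def)
  then obtain M where M: "perfect_matching G M" "card (M \<inter> cut G S) \<noteq> 1"
    using S' by (auto simp: tight_cut_def Int_commute)
  have M3: "card (M \<inter> cut G S) \<ge> 3" using M odd[OF M(1)] by presburger
  let ?P = "{M. perfect_matching G M}"
  have "card (?P - {M}) = card ?P - 1" "card ?P > 0"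
    using M fin by (auto simp: card_gt_0_iff)
  moreover have "(\<Sum>N\<in>?P - {M}. 1) \<le> (\<Sum>N\<in>?P - {M}. card (N \<inter> cut G S))"
    by (rule sum_mono) (use odd in \<open>force simp: odd_pos Suc_le_eq\<close>)
  moreover have "(\<Sum>N\<in>?P. card (N \<inter> cut G S)) = card (M \<inter> cut G S) + (\<Sum>N\<in>?P - {M}. card (N \<inter> cut G S))"
    using M fin by (intro sum.remove) auto
  moreover have "(\<Sum>N\<in>?P. card (N \<inter> cut G S)) = 2 * card (cut G S)"
    by (rule double_covered_card) (auto simp: cut_def)
  ultimately show ?thesis using M3 by simp
qed

text \<open>The number of perfect matchings is at least the dimension of the space of edge vectors
  with equal sums at all vertices: a vector \<open>f\<close> with zero sums at all vertices that is orthogonal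
  to all perfect matchings could be added with a small weight to the uniform fractional perfect
  matching, and the matching provided by Edmonds' theorem for the weight \<open>f\<close> would not be
  orthogonal to \<open>f\<close>.\<close>
lemma double_covered_brick_card_edges:
  assumes br: "brick G"
  shows "card (edges G) + 1 \<le> card {M. perfect_matching G M} + card (verts G)"
proof (rule ccontr)
  let ?P = "{M. perfect_matching G M}"
  define p where "p = card ?P"
  assume "\<not> ?thesis"
  then have ge: "card (edges G) \<ge> p + card (verts G)" by (simp add: p_def)
  have finV: "finite (verts G)" and finE: "finite (edges G)" using G by auto
  obtain v0 where v0: "v0 \<in> verts G"
    using dc by (auto simp: matching_double_covered_def connected_graph_def)
  \<comment> \<open>The equation at \<open>v0\<close> is left out: each edge lies in two perfect
    matchings, so orthogonality to all of them makes the total of \<open>f\<close> zero, and this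
    implies the missing equation. The saving is the \<open>+ 1\<close> of the bound.\<close>
  define I :: "('e set + 'v) set" where "I = ?P <+> (verts G - {v0})"
  have finI: "finite I" using fin finV by (simp add: I_def)
  have "card (verts G) > 0" using v0 finV by (auto simp: card_gt_0_iff)
  then have cI: "card I < card (edges G)"
    using fin finV v0 ge by (simp add: I_def card_Plus p_def)
  define a :: "'e set + 'v \<Rightarrow> 'e \<Rightarrow> real" where
    "a i e = (case i of Inl M \<Rightarrow> of_bool (e \<in> M) | Inr v \<Rightarrow> of_bool (v \<in> ends G e))" for i e
  obtain f where f: "\<exists>e\<in>edges G. f e \<noteq> 0" "\<forall>i\<in>I. (\<Sum>e\<in>edges G. a i e * f e) = 0"
    using homogeneous_solution[OF finI finE cI, of a] by blast
  have restr: "(\<Sum>e\<in>edges G. of_bool (Q e) * f e) = (\<Sum>e\<in>{e \<in> edges G. Q e}. f e)" for Q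
    unfolding sum.inter_filter[OF finE] by (rule sum.cong) auto
  have fM: "(\<Sum>e\<in>M. f e) = 0" if M: "perfect_matching G M" for M
  proof -
    have "Inl M \<in> I" using M unfolding I_def by blast
    then have "(\<Sum>e\<in>edges G. of_bool (e \<in> M) * f e) = 0" using f(2) by (force simp: a_def)
    moreover have "{e \<in> edges G. e \<in> M} = M" using M by (auto simp: perfect_matching_def)
    ultimately show ?thesis unfolding restr by simp
  qed
  have "(\<Sum>M\<in>?P. \<Sum>e\<in>M \<inter> edges G. f e) = (\<Sum>M\<in>?P. 0)"
    using fM by (intro sum.cong) (auto simp: perfect_matching_def Int_absorb2)
  then have fE: "(\<Sum>e\<in>edges G. f e) = 0" using double_covered_sum[OF order.refl, of f] by simp
  have fv': "(\<Sum>e\<in>cut G {v}. f e) = 0" if "v \<in> verts G" "v \<noteq> v0" for v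
  proof -
    have "Inr v \<in> I" using that unfolding I_def by blast
    then have "(\<Sum>e\<in>edges G. of_bool (v \<in> ends G e) * f e) = 0" using f(2) by (force simp: a_def)
    then show ?thesis unfolding restr cut_singleton .
  qed
  have "(\<Sum>v\<in>verts G. \<Sum>e\<in>cut G {v}. f e) = (\<Sum>e\<in>cut G {v0}. f e) + (\<Sum>v\<in>verts G - {v0}. \<Sum>e\<in>cut G {v}. f e)"
    using finV v0 by (intro sum.remove) auto
  then have "(\<Sum>e\<in>cut G {v0}. f e) = 0"
    using fv' fE sum_cut_singletons_verts[OF G, of f] by simp
  with fv' have fv: "(\<Sum>e\<in>cut G {v}. f e) = 0" if "v \<in> verts G" for v using that by blast
  obtain e0 where e0: "e0 \<in> edges G" "f e0 \<noteq> 0" using f(1) by blast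
  obtain M0 where "perfect_matching G M0"
    using br e0 unfolding brick_def matching_covered_def by blast
  then have p: "p > 0" using fin by (auto simp: p_def card_gt_0_iff)
  \<comment> \<open>As \<open>p\<close> is twice the degree, this is the uniform value
    \<open>1 / d\<close>.\<close>
  define x :: "'e \<Rightarrow> real" where "x e = 2 / real p" for e
  have xcut: "(\<Sum>e\<in>C. x e) = real (2 * card C) / real p" for C by (simp add: x_def)
  have xv: "(\<Sum>e\<in>cut G {v}. x e) = 1" if "v \<in> verts G" for v
    using double_covered_regular[OF that] p by (simp add: xcut p_def)
  have xS: "(\<Sum>e\<in>cut G S. x e) > 1" if "nontriv G S" for S
  proof -
    have "real p < real (2 * card (cut G S))"
      using double_covered_nontriv_cut[OF br that] unfolding p_def by linarith
    then show ?thesis unfolding xcut using p by (simp add: field_simps)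
  qed
  have "frac_pm (G\<lparr>edges := {e \<in> edges G. x e > 0}\<rparr>) x"
    by (rule frac_pm_support[OF G _ xv]) (use xS in \<open>force simp: x_def\<close>)+
  then have frx: "frac_pm G x" using p by (simp add: x_def)
  obtain t where t: "t > 0" "\<forall>e\<in>edges G. x e + t * f e \<ge> 0"
    "\<forall>S. nontriv G S \<longrightarrow> (\<Sum>e\<in>cut G S. x e + t * f e) \<ge> 1"
    using perturb[OF frx f(1) fv xS] by blast
  define y where "y e = x e + t * f e" for e
  define H where "H = G\<lparr>edges := {e \<in> edges G. y e > 0}\<rparr>"
  have yv: "(\<Sum>e\<in>cut G {v}. y e) = 1" if "v \<in> verts G" for v
    using xv[OF that] fv[OF that] by (simp add: y_def sum.distrib sum_distrib_left[symmetric])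
  have "frac_pm H y"
    unfolding H_def by (rule frac_pm_support[OF G _ yv]) (use t in \<open>auto simp: y_def\<close>)
  then obtain M where M: "perfect_matching H M" "(\<Sum>e\<in>M. f e) \<ge> (\<Sum>e\<in>edges H. f e * y e)"
    using edmonds by blast
  have "perfect_matching G M"
    using M(1) perfect_matching_subgraph[where G = G and E = "edges H" and M = M] by (force simp: H_def)
  then have "(\<Sum>e\<in>edges H. f e * y e) \<le> 0" using M(2) fM by simp
  moreover have "(\<Sum>e\<in>edges H. f e * y e) = (\<Sum>e\<in>edges G. f e * y e)"
    using finE t(2) by (intro sum.mono_neutral_left) (force simp: H_def y_def)+
  \<comment> \<open>The first summand vanishes, so \<open>y\<close> has weight \<open>t\<close>
    times the squared norm of \<open>f\<close>, which is positive, while every perfect matching has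
    weight zero.\<close>
  moreover have "(\<Sum>e\<in>edges G. f e * y e) = (2 / p) * (\<Sum>e\<in>edges G. f e) + t * (\<Sum>e\<in>edges G. f e * f e)"
    unfolding sum_distrib_left y_def x_def sum.distrib[symmetric]
    by (rule sum.cong) (auto simp: algebra_simps)
  moreover have "(\<Sum>e\<in>edges G. f e * f e) > 0"
    using finE e0 by (intro sum_pos2[of _ e0]) (auto simp: zero_less_mult_iff linorder_neq_iff)
  ultimately show False using fE t(1) by (simp add: mult_le_0_iff)
qed

end

section \<open>Multiplicities of double covered bricks\<close>

lemma matching_count_4:
  assumes "distinct [p, q, r, s]"
  shows "matching_count m [p, q, r, s] = m p q * m r s + m p r * m q s + m p s * m q r"
  using assms by auto

text \<open>The numbering is that of \<open>T1\<close>: the nonadjacent pairs are the three edges of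
  the 6-cycle that are not added back to its complement.\<close>

definition octa :: "nat \<Rightarrow> nat \<Rightarrow> nat" where
  "octa i j = (if i = j \<or> {i, j} \<in> {{0, 5}, {1, 2}, {3, 4}} then 0 else 1)"

text \<open>In \<open>dbl\<close> the matchings through an edge are counted as matchings of the
  graph without its ends; \<open>cutc\<close> is the excess of nontrivial odd cuts;
  \<open>bound\<close> is \<open>n * d / 2 + 1 \<le> 2 * d + n\<close>, doubled to avoid the
  division.\<close>

locale double_covered_multiplicity =
  fixes V :: "'v set" and m :: "'v \<Rightarrow> 'v \<Rightarrow> nat" and d :: nat
  assumes finV: "finite V"
    and sym: "m u v = m v u"
    and irr [simp]: "m v v = 0"
    and reg: "v \<in> V \<Longrightarrow> (\<Sum>u\<in>V. m v u) = d"
    and dbl: "distinct (u # v # vs) \<Longrightarrow> set (u # v # vs) = V \<Longrightarrow> m u v > 0 \<Longrightarrow> matching_count m vs = 2"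
    and cutc: "X \<subseteq> V \<Longrightarrow> odd (card X) \<Longrightarrow> card X \<noteq> 1 \<Longrightarrow> card (V - X) \<noteq> 1 \<Longrightarrow>
      (\<Sum>u\<in>X. \<Sum>v\<in>V - X. m u v) \<ge> d + 1"
    and nonbip: "A \<union> B = V \<Longrightarrow> A \<inter> B = {} \<Longrightarrow>
      (\<exists>u\<in>A. \<exists>v\<in>A. m u v > 0) \<or> (\<exists>u\<in>B. \<exists>v\<in>B. m u v > 0)"
    and evenV: "even (card V)"
    and bound: "card V * d + 2 \<le> 4 * d + 2 * card V"
begin

text \<open>The degrees in \<open>X\<close> add up to \<open>card X * d\<close>, and at least
  \<open>d + 1\<close> of this leaves \<open>X\<close>. The double sum counts each inner edge twice.
  So, if the cut is nontrivial, three vertices span at most \<open>d - 1\<close> edges, and for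
  \<open>d = 3\<close> five vertices span at most five.\<close>

lemma inner:
  assumes X: "X \<subseteq> V" "odd (card X)" "card X \<noteq> 1" "card X + 1 \<noteq> card V"
  shows "(\<Sum>u\<in>X. \<Sum>v\<in>X. m u v) + d + 1 \<le> card X * d"
proof -
  have "finite X" using X(1) finV finite_subset by blast
  then have c: "card (V - X) \<noteq> 1"
    using X(4) card_Diff_subset[OF _ X(1)] card_mono[OF finV X(1)] by linarith
  have "(\<Sum>u\<in>X. \<Sum>v\<in>V. m u v) = card X * d" using reg X(1) by (simp add: subset_iff)
  moreover have "(\<Sum>v\<in>V. m u v) = (\<Sum>v\<in>V - X. m u v) + (\<Sum>v\<in>X. m u v)" for u
    by (rule sum.subset_diff[OF X(1) finV])
  ultimately have "(\<Sum>u\<in>X. \<Sum>v\<in>V - X. m u v) + (\<Sum>u\<in>X. \<Sum>v\<in>X. m u v) = card X * d"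
    by (simp add: sum.distrib)
  then show ?thesis using cutc[OF X(1-3) c] by simp
qed

lemma triple:
  assumes "a \<in> V" "b \<in> V" "c \<in> V" "a \<noteq> b" "a \<noteq> c" "b \<noteq> c" "card V \<ge> 6"
  shows "2 * (m a b + m a c + m b c) + d + 1 \<le> 3 * d"
  using inner[of "{a, b, c}"] assms by (simp add: sym[of b a] sym[of c a] sym[of c b])

lemma five:
  assumes "{a, b, c, e, f} \<subseteq> V" "distinct [a, b, c, e, f]" "card V \<ge> 8"
  shows "2 * (m a b + m a c + m a e + m a f + m b c + m b e + m b f + m c e + m c f + m e f) + d + 1 \<le> 5 * d"
  using inner[of "{a, b, c, e, f}"] assms
  by (simp add: sym[of b a] sym[of c a] sym[of e a] sym[of f a] sym[of c b] sym[of e b] sym[of f b]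
      sym[of e c] sym[of f c] sym[of f e])

lemma enum:
  obtains xs where "distinct xs" "set xs = V" "length xs = card V"
  using finite_distinct_list[OF finV] distinct_card by metis

lemma reg_list:
  assumes "distinct vs" "set vs = V" "v \<in> V"
  shows "sum_list (map (m v) vs) = d"
  using reg[OF assms(3)] assms(1,2) by (simp add: sum_list_distinct_conv_sum_set)

lemma edge_exists: "\<exists>u\<in>V. \<exists>v\<in>V. u \<noteq> v \<and> m u v > 0"
proof -
  obtain u v where "u \<in> V" "v \<in> V" "m u v > 0" using nonbip[of V "{}"] by auto
  then show ?thesis using irr by (metis less_irrefl)
qed

lemma card_ge_4: "card V \<ge> 4"
proof (rule ccontr)
  assume "\<not> ?thesis"
  then have "card V = 0 \<or> card V = 2" using evenV by presburger
  moreover have "card V \<noteq> 0" using edge_exists finV by auto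
  moreover have "card V \<noteq> 2"
  proof
    assume "card V = 2"
    then obtain a b where "V = {a, b}" "a \<noteq> b" by (auto simp: card_2_iff)
    then show False using nonbip[of "{a}" "{b}"] by auto
  qed
  ultimately show False by blast
qed

text \<open>Split the four vertices into two pairs. One pair is joined since the graph is not
  bipartite; by \<open>dbl\<close> the complementary pair then has multiplicity 2, and by
  \<open>dbl\<close> again so has the first.\<close>

lemma card_4:
  assumes "card V = 4"
  shows "\<exists>xs. distinct xs \<and> set xs = V \<and> length xs = 4 \<and>
    (\<forall>i<4. \<forall>j<4. m (xs ! i) (xs ! j) = (if i = j then 0 else 2))"
proof -
  obtain xs where xs: "distinct xs" "set xs = V" "length xs = 4" using enum assms by metis
  then obtain a b c e where l: "xs = [a, b, c, e]"
    by (auto simp: numeral_eq_Suc length_Suc_conv)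
  have opp: "m u v = 2 \<and> m w x = 2" if uvwx: "distinct [u, v, w, x]" "{u, v, w, x} = V" for u v w x
  proof -
    have "{u, v} \<union> {w, x} = V" "{u, v} \<inter> {w, x} = {}" using uvwx by auto
    from nonbip[OF this] have "m u v > 0 \<or> m w x > 0"
      by (simp add: sym[of v u] sym[of x w])
    moreover have "m w x = 2" if "m u v > 0"
      using dbl[of u v "[w, x]"] uvwx that by auto
    moreover have "m u v = 2" if "m w x > 0"
    proof -
      have "{w, x, u, v} = V" using uvwx by auto
      then show ?thesis using dbl[of w x "[u, v]"] uvwx that by auto
    qed
    ultimately show ?thesis by fastforce
  qed
  have "m a b = 2 \<and> m c e = 2" "m a c = 2 \<and> m b e = 2" "m a e = 2 \<and> m b c = 2"
    using opp[of a b c e] opp[of a c b e] opp[of a e b c] xs l by auto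
  then have "\<forall>i<4. \<forall>j<4. m (xs ! i) (xs ! j) = (if i = j then 0 else 2)"
    unfolding l by (simp add: numeral_eq_Suc All_less_Suc sym[of b a] sym[of c a] sym[of e a]
        sym[of c b] sym[of e b] sym[of e c])
  then show ?thesis using xs by blast
qed

section \<open>Degree at least three, and the octahedron on six vertices\<close>

lemma third_neighbour:
  assumes "u \<in> V" "v \<in> V" "m u v < d"
  obtains w where "w \<in> V" "w \<noteq> u" "w \<noteq> v" "m u w > 0"
proof -
  have "(\<Sum>w\<in>V - {v}. m u w) > 0"
    using reg[OF assms(1)] sum.remove[OF finV assms(2), of "m u"] assms(3) by simp
  then have "\<exists>w\<in>V - {v}. m u w > 0" by (rule contrapos_pp) simp
  then obtain w where "w \<in> V - {v}" "m u w > 0" by blast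
  then show ?thesis using that[of w] by (metis DiffD1 DiffD2 insertI1 irr less_irrefl)
qed

lemma m_le_d: "u \<in> V \<Longrightarrow> v \<in> V \<Longrightarrow> m u v \<le> d"
  using reg[of u] member_le_sum[of v V "m u"] finV by simp

lemma third_vertex:
  assumes "card V \<ge> 6" obtains w where "w \<in> V" "w \<noteq> u" "w \<noteq> v"
proof -
  have "card {u, v} \<le> 2" by (simp add: card_insert_if)
  then have "\<not> V \<subseteq> {u, v}" using card_mono[of "{u, v}" V] assms by auto
  then show ?thesis using that by auto
qed

text \<open>A triple spans at most \<open>d - 1\<close> edges. An edge of multiplicity below
  \<open>d\<close> extends to a triple spanning two edges, and one of multiplicity \<open>d\<close>
  spans too many by itself.\<close>

lemma d_ge_3:
  assumes "card V \<ge> 6"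
  shows "d \<ge> 3"
proof (rule ccontr)
  assume "\<not> ?thesis"
  then have d: "d \<le> 2" by simp
  obtain u v where uv: "u \<in> V" "v \<in> V" "u \<noteq> v" "m u v > 0" using edge_exists by blast
  have le: "m u v \<le> d" using m_le_d uv by simp
  show False
  proof (cases "m u v < d")
    case True
    then obtain w where "w \<in> V" "w \<noteq> u" "w \<noteq> v" "m u w > 0" using third_neighbour uv by metis
    then show False using triple[of u v w] uv assms d by simp
  next
    case False
    obtain w where "w \<in> V" "w \<noteq> u" "w \<noteq> v" using third_vertex[OF assms] by metis
    then show False using triple[of u v w] uv assms d le False by simp
  qed
qed

text \<open>The six numbers are the multiplicities on the four vertices off an edge of multiplicity
  \<open>\<mu>\<close>: \<open>a * f\<close>, \<open>b * e\<close>, \<open>c * g\<close> belong to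
  opposite pairs, the strict bounds to the four triangles. However 2 is split among the products,
  some triangle misses at most 2 of the total \<open>d + \<mu>\<close>, so it contains at least
  \<open>d\<close> edges.\<close>

lemma six_arith:
  fixes a b c e f g \<mu> :: nat
  assumes "a * f + b * e + c * g = 2" "a + b + g < d" "a + c + e < d" "b + c + f < d" "g + e + f < d"
    "a + b + c + e + f + g = d + \<mu>" "\<mu> \<ge> 2" "d = 4 \<or> d = 5"
  shows False
proof -
  have p2: "x = 1 \<and> y = 2 \<or> x = 2 \<and> y = 1" if "x * y = 2" for x y :: nat
  proof -
    have "x dvd 2" "y dvd 2" using that by (metis dvd_triv_left, metis dvd_triv_right)
    then have "x \<le> 2" "y \<le> 2" by (auto dest: dvd_imp_le)
    then have "x \<in> {0, 1, 2}" "y \<in> {0, 1, 2}" by auto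
    then show ?thesis using that by auto
  qed
  have p3: "(x = 2 \<and> y = 0 \<and> z = 0) \<or> (x = 0 \<and> y = 2 \<and> z = 0) \<or> (x = 0 \<and> y = 0 \<and> z = 2) \<or>
      (x = 1 \<and> y = 1 \<and> z = 0) \<or> (x = 1 \<and> y = 0 \<and> z = 1) \<or> (x = 0 \<and> y = 1 \<and> z = 1)"
    if "x + y + z = 2" for x y z :: nat
    using that by presburger
  have "(a * f = 2 \<and> b * e = 0 \<and> c * g = 0) \<or> (a * f = 0 \<and> b * e = 2 \<and> c * g = 0) \<or>
    (a * f = 0 \<and> b * e = 0 \<and> c * g = 2) \<or> (a * f = 1 \<and> b * e = 1 \<and> c * g = 0) \<or>
    (a * f = 1 \<and> b * e = 0 \<and> c * g = 1) \<or> (a * f = 0 \<and> b * e = 1 \<and> c * g = 1)"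
    using p3[OF assms(1)] .
  then show False
    using assms(2-) by (elim disjE conjE) (auto dest!: p2)
qed

lemma six_simple:
  assumes n: "card V = 6" and d: "d = 4 \<or> d = 5" and uv: "u \<in> V" "v \<in> V"
  shows "m u v \<le> 1"
proof (rule ccontr)
  assume "\<not> ?thesis"
  then have mu: "m u v \<ge> 2" by simp
  then have ne: "u \<noteq> v" using irr by fastforce
  have "card (V - {u, v}) = 4" using n uv ne finV by (simp add: card_Diff_subset)
  then obtain xs where "distinct xs" "set xs = V - {u, v}" "length xs = 4"
    using finite_distinct_list[of "V - {u, v}"] finV distinct_card by (metis finite_Diff)
  then obtain p q r s where l: "distinct [p, q, r, s]" "set [p, q, r, s] = V - {u, v}"
    by (auto simp: numeral_eq_Suc length_Suc_conv)
  then have V: "distinct [u, v, p, q, r, s]" "set [u, v, p, q, r, s] = V" using uv ne by auto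
  have pm: "m p q * m r s + m p r * m q s + m p s * m q r = 2"
    using dbl[of u v "[p, q, r, s]"] V mu matching_count_4[OF l(1)] by simp
  have R: "sum_list (map (m w) [u, v, p, q, r, s]) = d" if "w \<in> V" for w
    using reg_list[OF V that] .
  have inV: "p \<in> V" "q \<in> V" "r \<in> V" "s \<in> V" using V by auto
  note R' = R[OF uv(1)] R[OF uv(2)] R[OF inV(1)] R[OF inV(2)] R[OF inV(3)] R[OF inV(4)]
  have T: "m p q + m p r + m q r < d" "m p q + m p s + m q s < d" "m p r + m p s + m r s < d"
    "m q r + m q s + m r s < d"
    using triple[of p q r] triple[of p q s] triple[of p r s] triple[of q r s] inV V n by auto
  \<comment> \<open>The four vertices have degree sum \<open>4 * d\<close>, of which
    \<open>2 * (d - m u v)\<close> goes to \<open>u\<close> and \<open>v\<close>.\<close>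
  have "m p q + m p r + m p s + m q s + m r s + m q r = d + m u v"
    using R' by (simp add: sym[of v u] sym[of p u] sym[of q u] sym[of r u] sym[of s u]
       sym[of p v] sym[of q v] sym[of r v] sym[of s v] sym[of q p] sym[of r p] sym[of s p]
       sym[of r q] sym[of s q] sym[of s r])
  then show False
    using six_arith[of "m p q" "m r s" "m p r" "m q s" "m p s" "m q r" "m u v"] pm T mu d by simp
qed

text \<open>The graph is simple. Degree 5 means \<open>K_6\<close>, where two vertices less leave
  three perfect matchings instead of two. Degree 4 gives each vertex exactly one other nonneighbour,
  and these pairs make the octahedron.\<close>

lemma card_6_big:
  assumes n: "card V = 6" and d: "d = 4 \<or> d = 5"
  shows "\<exists>xs. distinct xs \<and> set xs = V \<and> length xs = 6 \<and>
    (\<forall>i<6. \<forall>j<6. m (xs ! i) (xs ! j) = octa i j)"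
proof -
  note le1 = six_simple[OF n d]
  define Z where "Z v = {u \<in> V. m v u = 0}" for v
  have cZ: "card (Z v) + d = 6" if v: "v \<in> V" for v
  proof -
    have "d = (\<Sum>u\<in>V. of_bool (u \<notin> Z v))"
      unfolding reg[OF v, symmetric]
    proof (rule sum.cong[OF refl])
      fix u assume u: "u \<in> V"
      show "m v u = of_bool (u \<notin> Z v)" using le1[OF v u] u by (cases "m v u") (auto simp: Z_def)
    qed
    also have "\<dots> = card (V - Z v)"
      using finV by (simp add: of_bool_def sum.inter_filter[symmetric] set_diff_eq)
    also have "\<dots> = 6 - card (Z v)"
      using finV n by (subst card_Diff_subset) (auto simp: Z_def)
    finally show ?thesis using card_mono[of V "Z v"] finV n by (auto simp: Z_def)
  qed
  have selfZ: "v \<in> Z v" if "v \<in> V" for v using that by (simp add: Z_def)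
  have one: "m u v = 1" if "u \<in> V" "v \<in> V" "v \<notin> Z u" for u v
    using le1[OF that(1,2)] that by (auto simp: Z_def le_Suc_eq)
  have Zsym: "u \<in> Z v \<longleftrightarrow> v \<in> Z u" if "u \<in> V" "v \<in> V" for u v
    using that by (simp add: Z_def sym[of u v])
  show ?thesis
  proof (cases "d = 5")
    case True
    have Z1: "Z v = {v}" if v: "v \<in> V" for v
      using cZ[OF v] selfZ[OF v] True by (auto simp: card_1_singleton_iff)
    obtain xs where xs: "distinct xs" "set xs = V" "length xs = 6" using enum n by metis
    then obtain u v p q r s where l: "xs = [u, v, p, q, r, s]"
      by (auto simp: numeral_eq_Suc length_Suc_conv)
    have "m x y = 1" if "x \<in> V" "y \<in> V" "x \<noteq> y" for x y using one[of x y] Z1 that by simp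
    then have "m u v = 1" "m p q = 1" "m p r = 1" "m p s = 1" "m q r = 1" "m q s = 1" "m r s = 1"
      using xs l by auto
    then show ?thesis using dbl[of u v "[p, q, r, s]"] xs l matching_count_4[of p q r s m] by simp
  next
    case False
    then have c2: "card (Z v) = 2" if "v \<in> V" for v using cZ[OF that] d by simp
    have opp: "\<exists>w\<in>V. w \<noteq> v \<and> Z v = {v, w} \<and> Z w = {v, w}" if v: "v \<in> V" for v
    proof -
      obtain w where w: "Z v = {v, w}" "w \<noteq> v"
        using c2[OF v] selfZ[OF v] by (auto simp: card_2_iff doubleton_eq_iff)
      then have wV: "w \<in> V" by (auto simp: Z_def)
      have "{v, w} \<subseteq> Z w" using Zsym[OF v wV] selfZ[OF wV] w by auto
      then have "Z w = {v, w}"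
        using c2[OF wV] w card_subset_eq[of "Z w" "{v, w}"] finV by (auto simp: Z_def)
      then show ?thesis using w wV by blast
    qed
    have pick: "\<exists>w\<in>V. w \<notin> set zs" if "length zs < 6" for zs
    proof (rule ccontr)
      assume "\<not> ?thesis"
      then have "card V \<le> card (set zs)" by (intro card_mono) auto
      then show False using that n card_length[of zs] by simp
    qed
    obtain x0 where x0: "x0 \<in> V" using pick[of "[]"] by auto
    obtain x5 where x5: "x5 \<in> V" "x5 \<noteq> x0" "Z x0 = {x0, x5}" "Z x5 = {x0, x5}" using opp[OF x0] by blast
    obtain x1 where x1: "x1 \<in> V" "x1 \<notin> {x0, x5}" using pick[of "[x0, x5]"] by auto
    obtain x2 where x2: "x2 \<in> V" "x2 \<noteq> x1" "Z x1 = {x1, x2}" "Z x2 = {x1, x2}" using opp[OF x1(1)] by blast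
    have x2': "x2 \<notin> {x0, x5}" using x2 x5 x1 by (auto simp: doubleton_eq_iff)
    obtain x3 where x3: "x3 \<in> V" "x3 \<notin> {x0, x5, x1, x2}" using pick[of "[x0, x5, x1, x2]"] by auto
    obtain x4 where x4: "x4 \<in> V" "x4 \<noteq> x3" "Z x3 = {x3, x4}" "Z x4 = {x3, x4}" using opp[OF x3(1)] by blast
    have x4': "x4 \<notin> {x0, x5, x1, x2}" using x2 x5 x3 x4 by (auto simp: doubleton_eq_iff)
    let ?xs = "[x0, x1, x2, x3, x4, x5]"
    have dis: "distinct ?xs" using x5 x1 x2 x2' x3 x4 x4' by auto
    have sub: "set ?xs \<subseteq> V" using x0 x1 x2 x3 x4 x5 by auto
    have "set ?xs = V"
      by (rule card_subset_eq[OF finV sub]) (use n distinct_card[OF dis] in simp)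
    moreover have "\<forall>i<6. \<forall>j<6. m (?xs ! i) (?xs ! j) = octa i j"
    proof -
      have z: "m u v = (if v \<in> Z u then 0 else 1)" if "u \<in> V" "v \<in> V" for u v
        using one[OF that] that by (auto simp: Z_def)
      show ?thesis using sub dis x2(3,4) x4(3,4) x5(3,4)
        by (auto simp: numeral_eq_Suc All_less_Suc z octa_def doubleton_eq_iff)
    qed
    ultimately show ?thesis using dis by (intro exI[of _ ?xs]) simp
  qed
qed

end

section \<open>Cubic bricks\<close>

lemma matching_count_sum:
  "distinct vs \<Longrightarrow> matching_count m (v # vs) = (\<Sum>u\<in>set vs. m v u * matching_count m (remove1 u vs))"
  by (simp add: sum_list_distinct_conv_sum_set)

lemma matching_count_forced:
  assumes "distinct vs" "w \<in> set vs" "m v w = 1" "\<And>u. u \<in> set vs \<Longrightarrow> u \<noteq> w \<Longrightarrow> m v u = 0"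
  shows "matching_count m (v # vs) = matching_count m (remove1 w vs)"
proof -
  have "matching_count m (v # vs) = (\<Sum>u\<in>{w}. m v u * matching_count m (remove1 u vs))"
    unfolding matching_count_sum[OF assms(1)] by (rule sum.mono_neutral_right) (use assms in auto)
  then show ?thesis using assms(3) by simp
qed

lemma matching_count_two:
  assumes "distinct vs" "w \<in> set vs" "m v w = 1" "w' \<in> set vs" "m v w' = 1" "w \<noteq> w'"
    "\<And>u. u \<in> set vs \<Longrightarrow> u \<noteq> w \<Longrightarrow> u \<noteq> w' \<Longrightarrow> m v u = 0"
  shows "matching_count m (v # vs) = matching_count m (remove1 w vs) + matching_count m (remove1 w' vs)"
proof -
  have "matching_count m (v # vs) = (\<Sum>u\<in>{w, w'}. m v u * matching_count m (remove1 u vs))"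
    unfolding matching_count_sum[OF assms(1)] by (rule sum.mono_neutral_right) (use assms in auto)
  then show ?thesis using assms(3,5,6) by simp
qed

lemma matching_count_6:
  assumes "distinct [p, q, r, s, y, z]"
  shows "matching_count m [p, q, r, s, y, z] =
    m p q * matching_count m [r, s, y, z] + m p r * matching_count m [q, s, y, z] + m p s * matching_count m [q, r, y, z]
    + m p y * matching_count m [q, r, s, z] + m p z * matching_count m [q, r, s, y]"
  using assms by (auto simp del: matching_count.simps(2) simp add: matching_count.simps(2)[of m p])

text \<open>Here \<open>p, q, r, s\<close> stand for the outer neighbours of a 4-cycle, with two
  edges left each, and \<open>y, z\<close> for the last two vertices. Each of \<open>y, z\<close>
  misses one of the four. If both miss the same one, it cannot reach degree 2; if not, the two
  missed ones are joined and there are exactly two perfect matchings.\<close>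

lemma ten_arith:
  fixes pq pr ps qr qs rs py qy ry sy pz qz rz sz :: nat
  assumes le: "py \<le> 1" "qy \<le> 1" "ry \<le> 1" "sy \<le> 1" "pz \<le> 1" "qz \<le> 1" "rz \<le> 1" "sz \<le> 1"
    and deg: "pq + pr + ps + py + pz = 2" "pq + qr + qs + qy + qz = 2" "pr + qr + rs + ry + rz = 2"
    "ps + qs + rs + sy + sz = 2" "py + qy + ry + sy = 3" "pz + qz + rz + sz = 3"
    and one: "pq * (ry * sz + rz * sy) + pr * (qy * sz + qz * sy) + ps * (qy * rz + qz * ry)
      + py * (qr * sz + qs * rz + qz * rs) + pz * (qr * sy + qs * ry + qy * rs) = 1"
  shows False
proof -
  have four: "(a = 0 \<and> b = 1 \<and> c = 1 \<and> e = 1) \<or> (a = 1 \<and> b = 0 \<and> c = 1 \<and> e = 1) \<or>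
      (a = 1 \<and> b = 1 \<and> c = 0 \<and> e = 1) \<or> (a = 1 \<and> b = 1 \<and> c = 1 \<and> e = 0)"
    if "a \<le> 1" "b \<le> 1" "c \<le> 1" "e \<le> 1" "a + b + c + e = 3" for a b c e :: nat
    using that by (auto simp: le_Suc_eq)
  show False
    using four[OF le(1-4) deg(5)] four[OF le(5-8) deg(6)] deg(1-4) one
    by (elim disjE conjE) (hypsubst_thin, simp)+
qed

lemma mem_nth_image:
  assumes "distinct xs" "S \<subseteq> {..<length xs}" "j < length xs"
  shows "xs ! j \<in> (!) xs ` S \<longleftrightarrow> j \<in> S"
  using assms by (auto simp: nth_eq_iff_index_eq subset_iff)

text \<open>Layers around vertex 0: its neighbours 1, 2, 3, then their further neighbours 4, 5 and
  6, 7 and 8, 9, which form the 6-cycle 4, 6, 9, 5, 7, 8.\<close>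

definition petersen_nb :: "nat list list" where
  "petersen_nb = [[1, 2, 3], [0, 4, 5], [0, 6, 7], [0, 8, 9], [1, 6, 8],
     [1, 7, 9], [2, 4, 9], [2, 5, 8], [3, 4, 7], [3, 5, 6]]"

definition petersen_table :: "nat \<Rightarrow> nat \<Rightarrow> nat" where
  "petersen_table i j = (if j \<in> set (petersen_nb ! i) then 1 else 0)"

context double_covered_multiplicity
begin

section \<open>Neighbourhoods and short cycles in the cubic case\<close>

definition nb :: "'v \<Rightarrow> 'v set" where
  "nb v = {u \<in> V. m v u > 0}"

lemma nb_subset: "nb v \<subseteq> V" by (auto simp: nb_def)
lemma nb_sym: "u \<in> V \<Longrightarrow> v \<in> nb u \<Longrightarrow> u \<in> nb v" by (simp add: nb_def sym[of v u])
lemma nb_irr: "v \<notin> nb v" by (simp add: nb_def)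

context
  assumes d: "d = 3" and n6: "card V \<ge> 6"
begin

text \<open>A triple spans at most two edges, but a repeated edge lies in a triple that spans
  three.\<close>

lemma cubic_le1:
  assumes "u \<in> V" "v \<in> V"
  shows "m u v \<le> 1"
proof (rule ccontr)
  assume *: "\<not> ?thesis"
  then have ne: "u \<noteq> v" by auto
  obtain w where "w \<in> V" "w \<noteq> u" "w \<noteq> v" "m u v + m u w \<ge> 3"
  proof (cases "m u v < d")
    case True
    then obtain w where "w \<in> V" "w \<noteq> u" "w \<noteq> v" "m u w > 0" using third_neighbour assms by metis
    then show ?thesis using that[of w] * by simp
  next
    case False
    obtain w where "w \<in> V" "w \<noteq> u" "w \<noteq> v" using third_vertex[OF n6] by metis
    then show ?thesis using that[of w] False d by simp
  qed
  then show False using triple[of u v w] assms ne n6 d by simp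
qed

lemma m_nb: "u \<in> V \<Longrightarrow> v \<in> V \<Longrightarrow> m u v = (if v \<in> nb u then 1 else 0)"
  using cubic_le1[of u v] by (cases "m u v") (auto simp: nb_def)

lemma card_nb:
  assumes "v \<in> V" shows "card (nb v) = 3"
proof -
  have "3 = (\<Sum>u\<in>V. m v u)" using reg[OF assms] d by simp
  also have "\<dots> = (\<Sum>u\<in>V. if u \<in> nb v then 1 else 0)"
    using m_nb[OF assms] by (intro sum.cong) auto
  also have "\<dots> = card (V \<inter> nb v)" using finV by (simp add: sum.inter_restrict[symmetric])
  finally show ?thesis using nb_subset[of v] by (simp add: Int_absorb1)
qed

lemma finite_nb: "finite (nb v)"
  using nb_subset finV finite_subset by blast

lemma nb_eq:
  assumes "v \<in> V" "{x, y, z} \<subseteq> nb v" "x \<noteq> y" "x \<noteq> z" "y \<noteq> z"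
  shows "nb v = {x, y, z}"
  using card_subset_eq[OF finite_nb assms(2)] card_nb[OF assms(1)] assms(3-5) by simp

lemma nb_third:
  assumes "v \<in> V" "x \<in> nb v" "y \<in> nb v" "x \<noteq> y"
  shows "\<exists>z. nb v = {x, y, z} \<and> z \<noteq> x \<and> z \<noteq> y"
proof -
  have "card (nb v - {x, y}) = 1"
    using card_nb[OF assms(1)] assms finite_nb[of v] by (simp add: card_Diff_subset)
  then obtain z where "nb v - {x, y} = {z}" by (auto simp: card_1_singleton_iff)
  then show ?thesis using assms by (intro exI[of _ z]) auto
qed

lemma nb_second:
  assumes "v \<in> V" "x \<in> nb v"
  shows "\<exists>y z. nb v = {x, y, z} \<and> y \<noteq> x \<and> z \<noteq> x \<and> y \<noteq> z"
proof -
  have "nb v \<noteq> {x}" using card_nb[OF assms(1)] by auto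
  then obtain y where "y \<in> nb v" "y \<noteq> x" using assms by blast
  then show ?thesis using nb_third[OF assms] by metis
qed

lemma no_triangle:
  assumes "b \<in> V" "a \<in> nb b" "c \<in> nb b"
  shows "c \<notin> nb a"
proof
  assume c: "c \<in> nb a"
  have "a \<in> V" "c \<in> V" "a \<noteq> b" "c \<noteq> b" "c \<noteq> a" using assms c nb_subset nb_irr by auto
  moreover have "m b a = 1" "m b c = 1" "m a c = 1" using m_nb assms c calculation by auto
  ultimately show False using triple[of a b c] assms(1) n6 d by (simp add: sym[of a b])
qed

text \<open>Without triangles, the three neighbours of \<open>v\<close> are joined to all three
  vertices outside \<open>nb v\<close>, so the graph is \<open>K_{3,3}\<close> and
  bipartite.\<close>

lemma not_card_6: "card V \<noteq> 6"
proof
  assume n: "card V = 6"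
  obtain v where v: "v \<in> V" using n by fastforce
  obtain a b c where abc: "nb v = {a, b, c}" "a \<noteq> b" "a \<noteq> c" "b \<noteq> c"
    using card_nb[OF v] by (auto simp: card_3_iff)
  define W where "W = V - {a, b, c}"
  have cW: "card W = 3" "finite W"
    using n abc nb_subset[of v] finV by (auto simp: W_def card_Diff_subset)
  have N: "nb x = W" if x: "x \<in> {a, b, c}" for x
  proof -
    have xV: "x \<in> V" "x \<in> nb v" using x abc nb_subset[of v] by auto
    have "nb x \<subseteq> W" using no_triangle[OF v xV(2)] abc(1) nb_subset[of x] by (auto simp: W_def)
    then show ?thesis using card_subset_eq[OF cW(2)] card_nb[OF xV(1)] cW(1) by simp
  qed
  have M: "nb y = {a, b, c}" if y: "y \<in> W" for y
  proof (rule nb_eq)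
    show "y \<in> V" using y by (simp add: W_def)
    have "y \<in> nb a" "y \<in> nb b" "y \<in> nb c" using y N by auto
    then show "{a, b, c} \<subseteq> nb y" using nb_sym[of _ y] abc(1) nb_subset[of v] by auto
  qed (use abc in auto)
  have "{a, b, c} \<union> W = V" "{a, b, c} \<inter> W = {}" using abc nb_subset[of v] by (auto simp: W_def)
  from nonbip[OF this] show False
  proof (elim disjE bexE)
    fix x y assume xy: "x \<in> {a, b, c}" "y \<in> {a, b, c}" "0 < m x y"
    then have "y \<in> nb x" using abc nb_subset[of v] by (auto simp: nb_def)
    then show False using N[OF xy(1)] xy(2) by (auto simp: W_def)
  next
    fix x y assume xy: "x \<in> W" "y \<in> W" "0 < m x y"
    then have "y \<in> nb x" by (auto simp: nb_def W_def)
    then show False using M[OF xy(1)] xy(2) by (auto simp: W_def)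
  qed
qed

text \<open>Five vertices span at most five edges. The 4-cycle and the third edge at
  \<open>a\<close> use all of them, so the outer neighbour of \<open>a\<close> sees no other vertex
  of the cycle.\<close>

lemma cycle_outer:
  assumes n8: "card V \<ge> 8" and V: "{a, b, c, e} \<subseteq> V" "distinct [a, b, c, e]"
    and nb: "b \<in> nb a" "c \<in> nb b" "e \<in> nb c" "a \<in> nb e"
  shows "\<exists>x\<in>V - {a, b, c, e}. nb a = {b, e, x} \<and> x \<notin> nb b \<and> x \<notin> nb c \<and> x \<notin> nb e"
proof -
  have e: "e \<in> nb a" using nb(4) nb_sym V by auto
  obtain x where x: "nb a = {b, e, x}" "x \<noteq> b" "x \<noteq> e"
    using nb_third[of a b e] nb(1) e V by auto
  have "c \<notin> nb a" using no_triangle[of b a c] nb V nb_sym[of a b] by auto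
  then have xs: "x \<in> V - {a, b, c, e}" using x nb_irr[of a] nb_subset[of a] by auto
  then have mm: "m a b = 1" "m a e = 1" "m a x = 1" "m b c = 1" "m c e = 1"
    using m_nb V nb x(1) e by auto
  have "{a, b, c, e, x} \<subseteq> V" "distinct [a, b, c, e, x]" using V xs by auto
  from five[OF this n8] have "m b x = 0" "m c x = 0" "m e x = 0"
    using mm d by simp_all
  then show ?thesis using xs x by (intro bexI[of _ x]) (auto simp: nb_def)
qed

lemma matching_count_nb_forced:
  assumes "v \<in> V" "nb v = {x, y, w}" "distinct vs" "set vs \<subseteq> V" "x \<notin> set vs" "y \<notin> set vs" "w \<in> set vs"
  shows "matching_count m (v # vs) = matching_count m (remove1 w vs)"
proof (rule matching_count_forced[OF assms(3,7)])
  show "m v w = 1" using m_nb[of v w] assms by auto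
  show "m v u = 0" if "u \<in> set vs" "u \<noteq> w" for u
    using m_nb[of v u] that assms by auto
qed

lemma matching_count_nb_two:
  assumes "v \<in> V" "nb v = {x, y, w}" "distinct vs" "set vs \<subseteq> V" "x \<notin> set vs" "y \<in> set vs" "w \<in> set vs" "y \<noteq> w"
  shows "matching_count m (v # vs) = matching_count m (remove1 y vs) + matching_count m (remove1 w vs)"
proof (rule matching_count_two[OF assms(3,6) _ assms(7) _ assms(8)])
  show "m v w = 1" "m v y = 1" using m_nb[of v w] m_nb[of v y] assms by auto
  show "m v u = 0" if "u \<in> set vs" "u \<noteq> y" "u \<noteq> w" for u
    using m_nb[of v u] that assms by auto
qed

text \<open>Let \<open>Y\<close> be the set of vertices off the cycle and \<open>R\<close> what remains of it when the outer
  neighbours \<open>a', b', c', e'\<close> are removed. Counting the perfect matchings through single edges shows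
  that the number of perfect matchings on \<open>R\<close> is \<open>2 h - 2\<close>, where \<open>h\<close> is the number on \<open>Y\<close>.
  This is impossible for \<open>R = {}\<close>; for two nonadjacent vertices in \<open>R\<close> it means \<open>h = 1\<close>,
  while the degrees force \<open>h = 2\<close>.\<close>
lemma no_4_cycle:
  assumes n: "card V = 8 \<or> card V = 10" and V: "{a, b, c, e} \<subseteq> V" "distinct [a, b, c, e]"
    and nb: "b \<in> nb a" "c \<in> nb b" "e \<in> nb c" "a \<in> nb e"
  shows False
proof -
  have n8: "card V \<ge> 8" using n by auto
  obtain a' where a': "a' \<in> V - {a, b, c, e}" "nb a = {b, e, a'}" "a' \<notin> nb b" "a' \<notin> nb c" "a' \<notin> nb e"
    using cycle_outer[OF n8 V nb] by blast
  have "{b, c, e, a} \<subseteq> V" "distinct [b, c, e, a]" using V by auto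
  from cycle_outer[OF n8 this nb(2) nb(3) nb(4) nb(1)]
  obtain b' where b': "b' \<in> V - {b, c, e, a}" "nb b = {c, a, b'}"
    "b' \<notin> nb c" "b' \<notin> nb e" "b' \<notin> nb a"
    by blast
  have "{c, e, a, b} \<subseteq> V" "distinct [c, e, a, b]" using V by auto
  from cycle_outer[OF n8 this nb(3) nb(4) nb(1) nb(2)]
  obtain c' where c': "c' \<in> V - {c, e, a, b}" "nb c = {e, b, c'}"
    "c' \<notin> nb e" "c' \<notin> nb a" "c' \<notin> nb b"
    by blast
  have "{e, a, b, c} \<subseteq> V" "distinct [e, a, b, c]" using V by auto
  from cycle_outer[OF n8 this nb(4) nb(1) nb(2) nb(3)]
  obtain e' where e': "e' \<in> V - {e, a, b, c}" "nb e = {a, c, e'}"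
    "e' \<notin> nb a" "e' \<notin> nb b" "e' \<notin> nb c"
    by blast
  have dis: "distinct [a, b, c, e, a', b', c', e']"
    using V a' b' c' e' by auto
  have sub: "{a, b, c, e, a', b', c', e'} \<subseteq> V" using V a' b' c' e' by auto
  obtain R where R: "distinct R" "set R = V - {a, b, c, e, a', b', c', e'}"
    using finite_distinct_list[of "V - {a, b, c, e, a', b', c', e'}"] finV by auto
  have lR: "length R + 8 = card V"
  proof -
    have "card {a, b, c, e, a', b', c', e'} = 8" using distinct_card[OF dis] by simp
    then have "card (set R) = card V - 8" unfolding R(2) using sub finV by (simp add: card_Diff_subset)
    then show ?thesis using distinct_card[OF R(1)] n8 by simp
  qed
  let ?Y = "a' # b' # c' # e' # R"
  have full: "distinct (a # b # c # e # ?Y)" "set (a # b # c # e # ?Y) = V"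
    using dis R sub by auto
  have RV: "set R \<subseteq> V" using R by auto
  have inV: "a \<in> V" "b \<in> V" "c \<in> V" "e \<in> V" "a' \<in> V" "b' \<in> V" "c' \<in> V" "e' \<in> V"
    using sub by auto
  have pos: "m a b > 0" "m b c > 0" "m c e > 0" "m a a' > 0"
    using a'(2) b'(2) c'(2) by (auto simp: nb_def set_eq_iff)
  note facts = full(1) RV inV
  \<comment> \<open>Without \<open>a\<close> and \<open>b\<close>, the vertex \<open>c\<close> is
    matched to \<open>e\<close> or to \<open>c'\<close>, and in the second case \<open>e\<close> is
    forced to \<open>e'\<close>. The next two equations do the same for other edges of the
    cycle.\<close>
  have eq1: "matching_count m ?Y + matching_count m (a' # b' # R) = 2"
  proof -
    have "matching_count m (c # e # ?Y) = 2"
    proof (rule dbl[of a b])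
      show "distinct (a # b # c # e # ?Y)" using full(1) by auto
      show "set (a # b # c # e # ?Y) = V" unfolding full(2)[symmetric] by auto
    qed (rule pos(1))
    moreover have "matching_count m (c # e # ?Y) = matching_count m (remove1 e (e # ?Y)) + matching_count m (remove1 c' (e # ?Y))"
      by (rule matching_count_nb_two[of c b e c']) (use facts c'(2) in \<open>auto simp: insert_commute\<close>)
    moreover have "matching_count m (e # a' # b' # e' # R) = matching_count m (remove1 e' (a' # b' # e' # R))"
      by (rule matching_count_nb_forced[of e a c e']) (use facts e'(2) in \<open>auto simp: insert_commute\<close>)
    ultimately show ?thesis using full(1) by auto
  qed
  have eq2: "matching_count m ?Y + matching_count m (c' # e' # R) = 2"
  proof -
    have "matching_count m (a # b # ?Y) = 2"
    proof (rule dbl[of c e])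
      show "distinct (c # e # a # b # ?Y)" using full(1) by auto
      show "set (c # e # a # b # ?Y) = V" unfolding full(2)[symmetric] by auto
    qed (rule pos(3))
    moreover have "matching_count m (a # b # ?Y) = matching_count m (remove1 b (b # ?Y)) + matching_count m (remove1 a' (b # ?Y))"
      by (rule matching_count_nb_two[of a e b a']) (use facts a'(2) in \<open>auto simp: insert_commute\<close>)
    moreover have "matching_count m (b # b' # c' # e' # R) = matching_count m (remove1 b' (b' # c' # e' # R))"
      by (rule matching_count_nb_forced[of b a c b']) (use facts b'(2) in \<open>auto simp: insert_commute\<close>)
    ultimately show ?thesis using full(1) by auto
  qed
  have eq3: "matching_count m ?Y + matching_count m (b' # c' # R) = 2"
  proof -
    have "matching_count m (a # e # ?Y) = 2"
    proof (rule dbl[of b c])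
      show "distinct (b # c # a # e # ?Y)" using full(1) by auto
      show "set (b # c # a # e # ?Y) = V" unfolding full(2)[symmetric] by auto
    qed (rule pos(2))
    moreover have "matching_count m (a # e # ?Y) = matching_count m (remove1 e (e # ?Y)) + matching_count m (remove1 a' (e # ?Y))"
      by (rule matching_count_nb_two[of a b e a']) (use facts a'(2) in \<open>auto simp: insert_commute\<close>)
    moreover have "matching_count m (e # b' # c' # e' # R) = matching_count m (remove1 e' (b' # c' # e' # R))"
      by (rule matching_count_nb_forced[of e a c e']) (use facts e'(2) in \<open>auto simp: insert_commute\<close>)
    ultimately show ?thesis using full(1) by auto
  qed
  \<comment> \<open>Without \<open>a\<close> and \<open>a'\<close>, the rest of the cycle is covered
    in three ways: \<open>b c\<close> and \<open>e e'\<close>; \<open>b b'\<close> and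
    \<open>c e\<close>; \<open>b b'\<close>, \<open>c c'\<close> and \<open>e e'\<close>.\<close>
  have eq4: "matching_count m (b' # c' # R) + matching_count m (c' # e' # R) + matching_count m R = 2"
  proof -
    have "matching_count m (b # c # e # b' # c' # e' # R) = 2"
    proof (rule dbl[of a a'])
      show "distinct (a # a' # b # c # e # b' # c' # e' # R)" using full(1) by auto
      show "set (a # a' # b # c # e # b' # c' # e' # R) = V" unfolding full(2)[symmetric] by auto
    qed (rule pos(4))
    moreover have "matching_count m (b # c # e # b' # c' # e' # R) = matching_count m (remove1 c (c # e # b' # c' # e' # R)) + matching_count m (remove1 b' (c # e # b' # c' # e' # R))"
      by (rule matching_count_nb_two[of b a c b']) (use facts b'(2) in \<open>auto simp: insert_commute\<close>)
    moreover have "matching_count m (e # b' # c' # e' # R) = matching_count m (remove1 e' (b' # c' # e' # R))"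
      by (rule matching_count_nb_forced[of e a c e']) (use facts e'(2) in \<open>auto simp: insert_commute\<close>)
    moreover have "matching_count m (c # e # c' # e' # R) = matching_count m (remove1 e (e # c' # e' # R)) + matching_count m (remove1 c' (e # c' # e' # R))"
      by (rule matching_count_nb_two[of c b e c']) (use facts c'(2) in \<open>auto simp: insert_commute\<close>)
    moreover have "matching_count m (e # e' # R) = matching_count m (remove1 e' (e' # R))"
      by (rule matching_count_nb_forced[of e a c e']) (use facts e'(2) in \<open>auto simp: insert_commute\<close>)
    ultimately show ?thesis using full(1) by auto
  qed
  have par: "matching_count m R + 2 = 2 * matching_count m ?Y" using eq2 eq3 eq4 by linarith
  show False
  proof (cases "card V = 8")
    case True
    then have "R = []" using lR by simp
    then have "matching_count m R = 1" by simp
    then show False using par by presburger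
  next
    case False
    then have "length R = 2" using n lR by simp
    then obtain y w where yw: "R = [y, w]" by (auto simp: numeral_eq_Suc length_Suc_conv)
    have yV: "y \<in> V" "w \<in> V" "y \<noteq> w" using R yw by auto
    have "matching_count m R = m y w" by (simp add: yw)
    moreover have "m y w \<le> 1" using cubic_le1 yV by simp
    \<comment> \<open>By \<open>par\<close> the number \<open>m y w\<close> is even, and it is at
      most 1.\<close>
    ultimately have zero: "m y w = 0" and h: "matching_count m ?Y = 1" using par by presburger+
    note full = full[unfolded yw]
    have D: "sum_list (map (m v) [a, b, c, e, a', b', c', e', y, w]) = 3" if "v \<in> V" for v
      using reg_list[OF full that] d by simp
    have col: "m x a = (if x \<in> {b, e, a'} then 1 else 0)" "m x b = (if x \<in> {c, a, b'} then 1 else 0)"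
      "m x c = (if x \<in> {e, b, c'} then 1 else 0)" "m x e = (if x \<in> {a, c, e'} then 1 else 0)"
      if "x \<in> V" for x
      unfolding a'(2)[symmetric] b'(2)[symmetric] c'(2)[symmetric] e'(2)[symmetric]
      using m_nb[OF _ that] inV by (simp_all add: sym[of x])
    have y0: "m x a = 0" "m x b = 0" "m x c = 0" "m x e = 0" if "x \<in> {y, w}" for x
      using that full(1) yV by (auto simp: col)
    have p0: "m a' a = 1" "m a' b = 0" "m a' c = 0" "m a' e = 0"
      "m b' a = 0" "m b' b = 1" "m b' c = 0" "m b' e = 0"
      "m c' a = 0" "m c' b = 0" "m c' c = 1" "m c' e = 0"
      "m e' a = 0" "m e' b = 0" "m e' c = 0" "m e' e = 1"
      using full(1) inV by (auto simp: col)
    have le: "m a' y \<le> 1" "m b' y \<le> 1" "m c' y \<le> 1" "m e' y \<le> 1"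
      "m a' w \<le> 1" "m b' w \<le> 1" "m c' w \<le> 1" "m e' w \<le> 1"
      using cubic_le1 sub yV by auto
    have deg: "m a' b' + m a' c' + m a' e' + m a' y + m a' w = 2"
      "m a' b' + m b' c' + m b' e' + m b' y + m b' w = 2"
      "m a' c' + m b' c' + m c' e' + m c' y + m c' w = 2"
      "m a' e' + m b' e' + m c' e' + m e' y + m e' w = 2"
      "m a' y + m b' y + m c' y + m e' y = 3"
      "m a' w + m b' w + m c' w + m e' w = 3"
      using D[of a'] D[of b'] D[of c'] D[of e'] D[of y] D[of w] y0[of y] y0[of w] p0 sub yV zero
      by (simp_all add: sym[of b' a'] sym[of c' a'] sym[of e' a'] sym[of c' b'] sym[of e' b'] sym[of e' c']
          sym[of y a'] sym[of y b'] sym[of y c'] sym[of y e'] sym[of w a'] sym[of w b'] sym[of w c']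
          sym[of w e'] sym[of w y])
    have dY: "distinct [a', b', c', e', y, w]" using full(1) by simp
    have "distinct [c', e', y, w]" "distinct [b', e', y, w]" "distinct [b', c', y, w]"
      "distinct [b', c', e', w]" "distinct [b', c', e', y]" using dY by auto
    note p4 = this[THEN matching_count_4]
    have "matching_count m [a', b', c', e', y, w] = 1" using h unfolding yw .
    then have "m a' b' * (m c' y * m e' w + m c' w * m e' y) + m a' c' * (m b' y * m e' w + m b' w * m e' y)
      + m a' e' * (m b' y * m c' w + m b' w * m c' y)
      + m a' y * (m b' c' * m e' w + m b' e' * m c' w + m b' w * m c' e')
      + m a' w * (m b' c' * m e' y + m b' e' * m c' y + m b' y * m c' e') = 1"
      unfolding matching_count_6[OF dY] p4 zero by (simp only: mult_0_right add_0)
    from ten_arith[OF le deg this] show False .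
  qed
qed

section \<open>The Petersen graph from the absence of triangles and 4-cycles\<close>

lemma common_nb:
  assumes n: "card V = 8 \<or> card V = 10" and V: "x \<in> V" "y \<in> V" "x \<noteq> y"
    and nb: "u \<in> nb x" "u \<in> nb y" "w \<in> nb x" "w \<in> nb y"
  shows "u = w"
proof (rule ccontr)
  assume "u \<noteq> w"
  moreover have "x \<in> nb u" "y \<in> nb w" "x \<noteq> u" "x \<noteq> w" "y \<noteq> u" "y \<noteq> w"
    using nb nb_sym V nb_irr by auto
  ultimately show False
    using no_4_cycle[OF n, of u x w y] nb V nb_subset by auto
qed

text \<open>A vertex, its three neighbours and their six further neighbours are ten distinct
  vertices, as there are no triangles and 4-cycles. This excludes 8 vertices and exhausts 10; the
  edges among the last six are then determined up to naming.\<close>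

lemma petersen_labelling:
  assumes n: "card V = 8 \<or> card V = 10"
  shows "\<exists>xs. distinct xs \<and> set xs = V \<and> length xs = 10 \<and>
    (\<forall>i<10. \<forall>j<10. m (xs ! i) (xs ! j) = petersen_table i j)"
proof -
  have inV: "x \<in> V" if "x \<in> nb y" for x y using that nb_subset by blast
  obtain v where v: "v \<in> V" using n by fastforce
  obtain a b c where abc: "nb v = {a, b, c}" "a \<noteq> b" "a \<noteq> c" "b \<noteq> c"
    using card_nb[OF v] by (auto simp: card_3_iff)
  have abcV: "a \<in> V" "b \<in> V" "c \<in> V" using abc inV by auto
  have va: "v \<in> nb a" "v \<in> nb b" "v \<in> nb c" using nb_sym[OF v] abc by auto
  obtain a1 a2 where A: "nb a = {v, a1, a2}" "a1 \<noteq> v" "a2 \<noteq> v" "a1 \<noteq> a2"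
    using nb_second[OF abcV(1) va(1)] by blast
  obtain b3 b4 where B: "nb b = {v, b3, b4}" "b3 \<noteq> v" "b4 \<noteq> v" "b3 \<noteq> b4"
    using nb_second[OF abcV(2) va(2)] by blast
  obtain c3 c4 where C: "nb c = {v, c3, c4}" "c3 \<noteq> v" "c4 \<noteq> v" "c3 \<noteq> c4"
    using nb_second[OF abcV(3) va(3)] by blast
  have far: "x \<notin> nb v" if "y \<in> nb v" "x \<in> nb y" for x y
    using no_triangle[OF inV[OF that(1)] nb_sym[OF v that(1)] that(2)] .
  have sep: "x \<notin> nb z" if "y \<in> nb v" "z \<in> nb v" "y \<noteq> z" "x \<in> nb y" "x \<noteq> v" for x y z
    using common_nb[OF n inV[OF that(1)] inV[OF that(2)] that(3) that(4) _ nb_sym[OF v that(1)] nb_sym[OF v that(2)]]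
      that(5) by blast
  have AV: "a1 \<in> V" "a2 \<in> V" "b3 \<in> V" "b4 \<in> V" "c3 \<in> V" "c4 \<in> V"
    using A B C inV by auto
  have out: "{a1, a2, b3, b4, c3, c4} \<inter> {v, a, b, c} = {}"
    using far[of a a1] far[of a a2] far[of b b3] far[of b b4] far[of c c3] far[of c c4] abc A B C
    by auto
  have AB: "{a1, a2} \<inter> {b3, b4} = {}" using sep[of a b a1] sep[of a b a2] abc A B by auto
  have AC: "{a1, a2} \<inter> {c3, c4} = {}" using sep[of a c a1] sep[of a c a2] abc A C by auto
  have BC: "{b3, b4} \<inter> {c3, c4} = {}" using sep[of b c b3] sep[of b c b4] abc B C by auto
  have vabc: "v \<noteq> a" "v \<noteq> b" "v \<noteq> c" using abc nb_irr[of v] by auto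
  have dis0: "distinct [v, a, b, c, a1, a2, b3, b4, c3, c4]"
    using vabc abc A B C out AB AC BC by auto
  have sub0: "set [v, a, b, c, a1, a2, b3, b4, c3, c4] \<subseteq> V" using v abcV AV by auto
  have V: "set [v, a, b, c, a1, a2, b3, b4, c3, c4] = V"
    by (rule card_seteq[OF finV sub0]) (use n distinct_card[OF dis0] in auto)
  \<comment> \<open>Two neighbours of \<open>w\<close> below \<open>b\<close> would be two common
    neighbours of \<open>w\<close> and \<open>b\<close>, and likewise for \<open>c\<close>; so there
    is one below each.\<close>
  have outer: "\<exists>\<beta>\<in>{b3, b4}. \<exists>\<gamma>\<in>{c3, c4}. nb w = {a, \<beta>, \<gamma>}" if w: "w \<in> {a1, a2}" for w
  proof -
    have wV: "w \<in> V" "w \<in> nb a" "w \<noteq> v" using w AV A by auto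
    obtain p q where pq: "nb w = {a, p, q}" "p \<noteq> a" "q \<noteq> a" "p \<noteq> q"
      using nb_second[OF wV(1) nb_sym[OF abcV(1) wV(2)]] by blast
    have in_BC: "x \<in> {b3, b4, c3, c4}" if x: "x \<in> nb w" "x \<noteq> a" for x
    proof -
      have "w \<in> nb x" using nb_sym[OF wV(1) x(1)] .
      moreover have "w \<notin> {a, b, c}" "w \<notin> {v, b3, b4}" "w \<notin> {v, c3, c4}"
        using w out AB AC wV by auto
      ultimately have "x \<noteq> v" "x \<noteq> b" "x \<noteq> c" using abc B C by auto
      moreover have "x \<notin> {a1, a2}"
        using no_triangle[OF abcV(1) wV(2), of x] x A by auto
      ultimately show ?thesis using inV[OF x(1)] x(2) unfolding V[symmetric] by auto
    qed
    have nB: "\<not> (p \<in> {b3, b4} \<and> q \<in> {b3, b4})"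
    proof
      assume "p \<in> {b3, b4} \<and> q \<in> {b3, b4}"
      then have "p \<in> nb b" "q \<in> nb b" using B by auto
      then show False
        using common_nb[OF n wV(1) abcV(2), of p q] pq w out by auto
    qed
    have nC: "\<not> (p \<in> {c3, c4} \<and> q \<in> {c3, c4})"
    proof
      assume "p \<in> {c3, c4} \<and> q \<in> {c3, c4}"
      then have "p \<in> nb c" "q \<in> nb c" using C by auto
      then show False
        using common_nb[OF n wV(1) abcV(3), of p q] pq w out by auto
    qed
    have "p \<in> {b3, b4, c3, c4}" "q \<in> {b3, b4, c3, c4}" using in_BC pq by auto
    then have "p \<in> {b3, b4} \<and> q \<in> {c3, c4} \<or> q \<in> {b3, b4} \<and> p \<in> {c3, c4}" using nB nC by blast
    moreover have "nb w = {a, q, p}" using pq(1) by auto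
    ultimately show ?thesis using pq(1) by blast
  qed
  \<comment> \<open>The vertices below \<open>b\<close> and \<open>c\<close> are renamed so that
    \<open>a1\<close> and \<open>a2\<close> see those with their own index.\<close>
  obtain b1 c1 where 1: "b1 \<in> {b3, b4}" "c1 \<in> {c3, c4}" "nb a1 = {a, b1, c1}" using outer[of a1] by blast
  obtain b2 c2 where 2: "b2 \<in> {b3, b4}" "c2 \<in> {c3, c4}" "nb a2 = {a, b2, c2}" using outer[of a2] by blast
  have common: "x = a" if "x \<in> nb a1" "x \<in> nb a2" for x
    using common_nb[OF n AV(1,2) A(4) that, of a] 1(3) 2(3) by blast
  have "b1 \<noteq> a" "c1 \<noteq> a" using 1 out by auto
  moreover have "b1 \<in> nb a1" "c1 \<in> nb a1" "b2 \<in> nb a2" "c2 \<in> nb a2"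
    unfolding 1(3) 2(3) by simp_all
  ultimately have ne: "b1 \<noteq> b2" "c1 \<noteq> c2" using common by blast+
  have b12: "{b3, b4} = {b1, b2}" using 1(1) 2(1) ne(1) by auto
  have c12: "{c3, c4} = {c1, c2}" using 1(2) 2(2) ne(2) by auto
  have B': "nb b = {v, b1, b2}" and C': "nb c = {v, c1, c2}" using B(1) C(1) b12 c12 by (simp_all only:)
  let ?xs = "[v, a, b, c, a1, a2, b1, b2, c1, c2]"
  have dis: "distinct ?xs" using dis0 1(1,2) 2(1,2) ne by auto
  have "set ?xs = {v, a, b, c, a1, a2} \<union> {b1, b2} \<union> {c1, c2}" by auto
  also have "\<dots> = V" unfolding b12[symmetric] c12[symmetric] V[symmetric] by auto
  finally have V': "set ?xs = V" .
  have bcV: "b1 \<in> V" "b2 \<in> V" "c1 \<in> V" "c2 \<in> V" using V' by auto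
  \<comment> \<open>The third neighbour of a vertex \<open>x\<close> below \<open>b\<close> lies
    below \<open>c\<close>. It is not \<open>z\<close>, which would close the triangle
    \<open>x\<close>, \<open>y\<close>, \<open>z\<close>.\<close>
  have last: "nb x = {b, y, z'}"
    if x: "x \<in> nb b" "y \<in> nb x" "y \<noteq> b" "x \<noteq> v" and zz: "{z, z'} = {c1, c2}" and "z \<in> nb y"
      and y: "{y, y'} = {a1, a2}" "x \<notin> nb y'" for x y z z' y'
  proof -
    have xV: "x \<in> V" using inV x by blast
    obtain w where w: "nb x = {b, y, w}" "w \<noteq> b" "w \<noteq> y"
      using nb_third[OF xV nb_sym[OF abcV(2) x(1)] x(2)] x(3) by auto
    have wx: "x \<in> nb w" "w \<in> nb x" using nb_sym[OF xV, of w] w by auto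
    have yV: "y \<in> V" using inV x by blast
    have "w \<notin> nb b" using no_triangle[OF xV nb_sym[OF abcV(2) x(1)] wx(2)] .
    moreover have "w \<noteq> v" using far[of b x] x wx abc by auto
    moreover have "w \<noteq> a" "w \<noteq> c" using sep[of b a x] sep[of b c x] abc x wx by auto
    moreover have "w \<noteq> y'" using y(2) wx by auto
    moreover have "w \<noteq> z" using no_triangle[OF yV nb_sym[OF xV x(2)] \<open>z \<in> nb y\<close>] wx by auto
    ultimately have "w = z'"
      using inV[OF wx(2)] w(2,3) y(1) zz B' unfolding V'[symmetric] by (auto simp: doubleton_eq_iff)
    then show ?thesis using w by simp
  qed
  have Nb1: "nb b1 = {b, a1, c2}"
    by (rule last[of _ _ c1 _ a2]) (use dis B' 1(3) 2(3) nb_sym[OF AV(1), of b1] in auto)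
  have Nb2: "nb b2 = {b, a2, c1}"
    by (rule last[of _ _ c2 _ a1]) (use dis B' 1(3) 2(3) nb_sym[OF AV(2), of b2] in auto)
  have Nc1: "nb c1 = {c, a1, b2}"
    by (rule nb_eq[OF bcV(3)])
      (use dis nb_sym[OF abcV(3), of c1] nb_sym[OF AV(1), of c1] nb_sym[OF bcV(2), of c1] C' 1(3) Nb2 in auto)
  have Nc2: "nb c2 = {c, a2, b1}"
    by (rule nb_eq[OF bcV(4)])
      (use dis nb_sym[OF abcV(3), of c2] nb_sym[OF AV(2), of c2] nb_sym[OF bcV(1), of c2] C' 2(3) Nb1 in auto)
  have nbs: "\<forall>i<10. nb (?xs ! i) = (!) ?xs ` set (petersen_nb ! i)"
    using abc(1) A(1) B' C' 1(3) 2(3) Nb1 Nb2 Nc1 Nc2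
    by (simp add: numeral_eq_Suc All_less_Suc petersen_nb_def)
  have "m (?xs ! i) (?xs ! j) = petersen_table i j" if ij: "i < 10" "j < 10" for i j
  proof -
    have "\<forall>k<10. \<forall>l\<in>set (petersen_nb ! k). l < 10"
      by (simp add: numeral_eq_Suc All_less_Suc petersen_nb_def)
    then have "set (petersen_nb ! i) \<subseteq> {..<10}" using ij by auto
    then have "set (petersen_nb ! i) \<subseteq> {..<length ?xs}" by (rule subset_trans) simp
    from mem_nth_image[OF dis this, of j]
    have "?xs ! j \<in> nb (?xs ! i) \<longleftrightarrow> j \<in> set (petersen_nb ! i)"
      using nbs ij by (simp del: nth_Cons_numeral)
    moreover have "?xs ! i \<in> V" "?xs ! j \<in> V" unfolding V'[symmetric] using ij by (auto intro!: nth_mem simp del: set_simps)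
    ultimately show ?thesis using m_nb[of "?xs ! i" "?xs ! j"] by (simp add: petersen_table_def)
  qed
  then show ?thesis using dis V' by (intro exI[of _ ?xs]) simp
qed

end

text \<open>For \<open>n\<close> vertices \<open>bound\<close> says
  \<open>d * (n - 4) \<le> 2 * n - 2\<close>. This gives \<open>d \<le> 5\<close> for 6 vertices and
  \<open>d \<le> 3\<close> for 8 and 10, and it contradicts \<open>d \<ge> 3\<close> from 12
  on.\<close>

theorem classification:
  "\<exists>xs. distinct xs \<and> set xs = V \<and>
    (length xs = 4 \<and> (\<forall>i<4. \<forall>j<4. m (xs ! i) (xs ! j) = (if i = j then 0 else 2)) \<or>
     length xs = 6 \<and> (\<forall>i<6. \<forall>j<6. m (xs ! i) (xs ! j) = octa i j) \<or>
     length xs = 10 \<and> (\<forall>i<10. \<forall>j<10. m (xs ! i) (xs ! j) = petersen_table i j))"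
proof (cases "card V = 4")
  case True
  then show ?thesis using card_4 by blast
next
  case False
  then have n6: "card V \<ge> 6" using card_ge_4 evenV by presburger
  note d3 = d_ge_3[OF n6]
  have "card V < 12"
  proof (rule ccontr)
    assume "\<not> ?thesis"
    then have n: "card V \<ge> 12" by simp
    obtain k where k: "d = 3 + k" using d3 le_Suc_ex by blast
    have "12 * k \<le> card V * k" using n by (rule mult_le_mono1)
    then show False using bound n unfolding k distrib_left by linarith
  qed
  then have "card V = 6 \<or> card V = 8 \<or> card V = 10" using n6 evenV by presburger
  then consider "card V = 6" | "card V = 8" | "card V = 10" by blast
  then show ?thesis
  proof cases
    case 1
    then have "d = 4 \<or> d = 5" using not_card_6[of] bound d3 n6 by fastforce
    then show ?thesis using card_6_big[OF 1] by blast
  next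
    case 2
    then have "d = 3" using bound d3 by simp
    then show ?thesis using petersen_labelling[OF _ n6] 2 by blast
  next
    case 3
    then have "d = 3" using bound d3 by simp
    then show ?thesis using petersen_labelling[OF _ n6] 3 by blast
  qed
qed

end

section \<open>Isomorphisms and the three graphs\<close>

lemma brick_double_covered_multiplicity:
  fixes G :: "('v, 'e) mgraph"
  assumes br: "brick G" and dc: "matching_double_covered G"
  shows "\<exists>d. double_covered_multiplicity (verts G) (mult G) d"
proof -
  have G: "graph G" and ne: "verts G \<noteq> {}"
    using dc by (auto simp: matching_double_covered_def connected_graph_def)
  let ?p = "card {M. perfect_matching G M}"
  obtain v0 where v0: "v0 \<in> verts G" using ne by blast
  define d where "d = card (cut G {v0})"
  have p: "?p = 2 * d" using double_covered_regular[OF dc v0] by (simp add: d_def)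
  have cut_d: "card (cut G {v}) = d" if "v \<in> verts G" for v
    using double_covered_regular[OF dc that] p by simp
  have "double_covered_multiplicity (verts G) (mult G) d"
  proof
    show "finite (verts G)" using G by simp
    show "mult G u v = mult G v u" for u v by (rule mult_commute)
    show "mult G v v = 0" for v by (rule mult_self[OF G])
    show "(\<Sum>u\<in>verts G. mult G v u) = d" if "v \<in> verts G" for v
      using card_cut_singleton_mult[OF G that] cut_d[OF that] by simp
    show "matching_count (mult G) vs = 2"
      if vs: "distinct (u # v # vs)" "set (u # v # vs) = verts G" "mult G u v > 0" for u v vs
    proof -
      obtain e where e: "e \<in> edges G" "ends G e = {u, v}" using vs(3) mult_pos_iff[OF G] by blast
      have "distinct vs" "set vs = verts G - {u, v}" using vs(1,2) by auto
      from card_perfect_matchings_edge[OF G e this] show ?thesis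
        using dc e(1) by (simp add: matching_double_covered_def)
    qed
    show "d + 1 \<le> (\<Sum>u\<in>X. \<Sum>v\<in>verts G - X. mult G u v)"
      if "X \<subseteq> verts G" "odd (card X)" "card X \<noteq> 1" "card (verts G - X) \<noteq> 1" for X
    proof -
      have "nontriv G X" using that by (simp add: nontriv_def trivial_cut_def)
      from double_covered_nontriv_cut[OF dc br this] show ?thesis
        using p card_cut_mult[OF G that(1)] by simp
    qed
    show nonbip: "(\<exists>u\<in>A. \<exists>v\<in>A. 0 < mult G u v) \<or> (\<exists>u\<in>B. \<exists>v\<in>B. 0 < mult G u v)"
      if AB: "A \<union> B = verts G" "A \<inter> B = {}" for A B
    proof (rule ccontr)
      assume *: "\<not> ?thesis"
      have "\<exists>a\<in>A. \<exists>b\<in>B. ends G e = {a, b}" if e: "e \<in> edges G" for e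
      proof -
        obtain p q where pq: "ends G e = {p, q}" "p \<in> verts G" "q \<in> verts G"
          using ends_obtain[OF G e] by metis
        then have "0 < mult G p q" using mult_pos_iff[OF G] e by blast
        then consider "p \<in> A" "q \<in> B" | "q \<in> A" "p \<in> B" using * pq(2,3) AB by blast
        then show ?thesis using pq(1) by cases (blast, metis insert_commute)
      qed
      then have "bipartite G" using AB unfolding bipartite_def by blast
      then show False using br by (simp add: brick_def)
    qed
    have "edges G \<noteq> {}"
    proof
      assume "edges G = {}"
      then have "bipartite G" unfolding bipartite_def by (intro exI[of _ "verts G"] exI[of _ "{}"]) simp
      then show False using br by (simp add: brick_def)
    qed
    then obtain e M where M: "perfect_matching G M"
      using br unfolding brick_def matching_covered_def by blast
    show "even (card (verts G))" by (rule perfect_matching_even[OF G M])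
    have "(\<Sum>v\<in>verts G. card (cut G {v})) = 2 * card (edges G)"
      using sum_cut_singletons_verts[OF G, of "\<lambda>_. 1 :: nat"] by simp
    moreover have "(\<Sum>v\<in>verts G. card (cut G {v})) = (\<Sum>v\<in>verts G. d)"
      using cut_d by (rule sum.cong[OF refl])
    ultimately have "card (verts G) * d = 2 * card (edges G)" by simp
    then show "card (verts G) * d + 2 \<le> 4 * d + 2 * card (verts G)"
      using double_covered_brick_card_edges[OF dc br] p by simp
  qed
  then show ?thesis ..
qed

text \<open>Each parallel class \<open>D P\<close> is mapped by an arbitrary bijection
  \<open>h P\<close> onto the class between the image vertices, and the edge map \<open>g\<close>
  collects these bijections.\<close>

lemma isomorphicI_mult:
  fixes G :: "('v, 'e) mgraph" and H :: "('w, 'f) mgraph"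
  assumes G: "graph G" and H: "graph H" and f: "bij_betw f (verts G) (verts H)"
    and m: "\<And>u v. u \<in> verts G \<Longrightarrow> v \<in> verts G \<Longrightarrow> mult H (f u) (f v) = mult G u v"
  shows "isomorphic G H"
proof -
  define D where "D P = {e \<in> edges G. ends G e = P}" for P
  define D' where "D' P = {e \<in> edges H. ends H e = P}" for P
  have inj: "inj_on f (verts G)" using f by (rule bij_betw_imp_inj_on)
  have "\<exists>h. bij_betw h (D P) (D' (f ` P))" if "P \<in> ends G ` edges G" for P
  proof -
    obtain e where e: "e \<in> edges G" "P = ends G e" using \<open>P \<in> _\<close> by blast
    obtain p q where pq: "P = {p, q}" "p \<in> verts G" "q \<in> verts G"
      using ends_obtain[OF G e(1)] e(2) by metis
    have "card (D P) = card (D' (f ` P))"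
      using m[OF pq(2,3)] by (simp add: pq(1) D_def D'_def mult_def)
    then show ?thesis using G H by (intro finite_same_card_bij) (simp_all add: D_def D'_def)
  qed
  then obtain h where h: "\<And>P. P \<in> ends G ` edges G \<Longrightarrow> bij_betw (h P) (D P) (D' (f ` P))" by metis
  define g where "g e = h (ends G e) e" for e
  have gD: "g e \<in> D' (f ` ends G e)" if "e \<in> edges G" for e
    using h[of "ends G e"] that bij_betwE by (fastforce simp: g_def D_def)
  then have gE: "g e \<in> edges H" "ends H (g e) = f ` ends G e" if "e \<in> edges G" for e
    using that by (auto simp: D'_def)
  have "bij_betw g (edges G) (edges H)"
    unfolding bij_betw_def
  proof
    show "inj_on g (edges G)"
    proof (rule inj_onI)
      fix e e' assume e: "e \<in> edges G" "e' \<in> edges G" "g e = g e'"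
      then have "f ` ends G e = f ` ends G e'" using gE(2) by metis
      then have P: "ends G e = ends G e'"
        using inj graph_ends(1)[OF G] e by (simp add: inj_on_image_eq_iff)
      then have "inj_on (h (ends G e)) (D (ends G e))" "e \<in> D (ends G e)" "e' \<in> D (ends G e)"
        using h[of "ends G e"] e by (auto simp: bij_betw_def D_def)
      then show "e = e'" using e(3) P by (auto simp: g_def inj_on_def)
    qed
    show "g ` edges G = edges H"
    proof
      show "g ` edges G \<subseteq> edges H" using gE by auto
      show "edges H \<subseteq> g ` edges G"
      proof
        fix e' assume e': "e' \<in> edges H"
        obtain p' q' where pq': "ends H e' = {p', q'}" "p' \<in> verts H" "q' \<in> verts H"
          using ends_obtain[OF H e'] by metis
        then obtain p q where pq: "p \<in> verts G" "q \<in> verts G" "p' = f p" "q' = f q"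
          using f by (metis bij_betw_imp_surj_on imageE)
        have "mult G p q > 0" using m[OF pq(1,2)] pq mult_pos_iff[OF H] e' pq'(1) by metis
        then obtain e where e: "e \<in> edges G" "ends G e = {p, q}" using mult_pos_iff[OF G] by blast
        have "e' \<in> D' (f ` {p, q})" using e' pq' pq by (simp add: D'_def)
        moreover have "bij_betw (h {p, q}) (D {p, q}) (D' (f ` {p, q}))" using h[of "{p, q}"] e by force
        ultimately obtain e2 where "e2 \<in> D {p, q}" "e' = h {p, q} e2"
          by (metis bij_betw_imp_surj_on imageE)
        then have "e2 \<in> edges G" "e' = g e2" by (simp_all add: D_def g_def)
        then show "e' \<in> g ` edges G" by blast
      qed
    qed
  qed
  then show ?thesis unfolding isomorphic_def using f gE(2) by blast
qed

lemma isomorphicI_nth: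
  fixes G :: "('v, 'e) mgraph" and H :: "('w, 'f) mgraph"
  assumes G: "graph G" and H: "graph H"
    and xs: "distinct xs" "set xs = verts G" and ys: "distinct ys" "set ys = verts H"
    and len: "length xs = n" "length ys = n"
    and m: "\<And>i j. i < n \<Longrightarrow> j < n \<Longrightarrow> mult G (xs ! i) (xs ! j) = mult H (ys ! i) (ys ! j)"
  shows "isomorphic G H"
proof -
  define f where "f = (\<lambda>x. ys ! (THE i. i < n \<and> xs ! i = x))"
  have f: "f (xs ! i) = ys ! i" if "i < n" for i
  proof -
    have "(THE j. j < n \<and> xs ! j = xs ! i) = i"
      using that xs(1) len by (intro the_equality) (auto simp: nth_eq_iff_index_eq)
    then show ?thesis by (simp add: f_def)
  qed
  have vG: "verts G = (!) xs ` {..<n}" using xs(2) len(1) by (auto simp: set_conv_nth)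
  have vH: "verts H = (!) ys ` {..<n}" using ys(2) len(2) by (auto simp: set_conv_nth)
  have "bij_betw f (verts G) (verts H)"
    unfolding bij_betw_def
  proof
    show "inj_on f (verts G)"
      unfolding vG using f ys(1) len by (auto simp: inj_on_def nth_eq_iff_index_eq)
    show "f ` verts G = verts H" unfolding vG vH using f by (force simp: image_image)
  qed
  moreover have "mult H (f u) (f v) = mult G u v" if "u \<in> verts G" "v \<in> verts G" for u v
    using that f m unfolding vG by auto
  ultimately show ?thesis by (rule isomorphicI_mult[OF G H])
qed

section \<open>Transfer of matching counts along isomorphisms\<close>

lemma remove1_map_inj:
  "inj_on f (insert u (set vs)) \<Longrightarrow> remove1 (f u) (map f vs) = map f (remove1 u vs)"
  by (induction vs) (auto simp: inj_on_def)

lemma matching_count_map: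
  assumes "inj_on f (set vs)" "\<And>x y. x \<in> set vs \<Longrightarrow> y \<in> set vs \<Longrightarrow> m' (f x) (f y) = m x y"
  shows "matching_count m' (map f vs) = matching_count m vs"
  using assms
proof (induction m vs rule: matching_count.induct)
  case (1 m)
  then show ?case by simp
next
  case (2 m v vs)
  have "matching_count m' (remove1 (f u) (map f vs)) = matching_count m (remove1 u vs)" if u: "u \<in> set vs" for u
  proof -
    have sub: "set (remove1 u vs) \<subseteq> set (v # vs)" using set_remove1_subset[of u vs] by auto
    have "matching_count m' (map f (remove1 u vs)) = matching_count m (remove1 u vs)"
      by (rule 2(1)[OF u inj_on_subset[OF 2(2) sub]]) (rule 2(3)[OF subsetD[OF sub] subsetD[OF sub]])
    moreover have "inj_on f (insert u (set vs))"
      by (rule inj_on_subset[OF 2(2)]) (use u in auto)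
    ultimately show ?thesis by (simp add: remove1_map_inj)
  qed
  then have "map (\<lambda>u. m' (f v) u * matching_count m' (remove1 u (map f vs))) (map f vs) =
    map (\<lambda>u. m v u * matching_count m (remove1 u vs)) vs"
    using 2(3) by simp
  then show ?case by (simp only: list.map matching_count.simps)
qed

lemma isomorphic_mult:
  fixes G :: "('v, 'e) mgraph" and H :: "('w, 'f) mgraph"
  assumes G: "graph G" and iso: "isomorphic G H"
  obtains f where "bij_betw f (verts G) (verts H)"
    "\<And>u v. u \<in> verts G \<Longrightarrow> v \<in> verts G \<Longrightarrow> mult H (f u) (f v) = mult G u v"
proof -
  obtain f g where fg: "bij_betw f (verts G) (verts H)" "bij_betw g (edges G) (edges H)"
    "\<forall>e\<in>edges G. ends H (g e) = f ` ends G e"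
    using iso by (auto simp: isomorphic_def)
  have inj: "inj_on f (verts G)" using fg(1) by (rule bij_betw_imp_inj_on)
  have "mult H (f u) (f v) = mult G u v" if uv: "u \<in> verts G" "v \<in> verts G" for u v
  proof -
    have ends: "ends H (g e) = {f u, f v} \<longleftrightarrow> ends G e = {u, v}" if e: "e \<in> edges G" for e
    proof -
      have "ends H (g e) = {f u, f v} \<longleftrightarrow> f ` ends G e = f ` {u, v}" using fg(3) e by simp
      also have "\<dots> \<longleftrightarrow> ends G e = {u, v}"
        using inj graph_ends(1)[OF G e] uv by (intro inj_on_image_eq_iff) auto
      finally show ?thesis .
    qed
    have surj: "edges H = g ` edges G" using fg(2) by (simp add: bij_betw_def)
    have "{e \<in> edges H. ends H e = {f u, f v}} = g ` {e \<in> edges G. ends H (g e) = {f u, f v}}"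
      unfolding surj by (rule Compr_image_eq)
    also have "{e \<in> edges G. ends H (g e) = {f u, f v}} = {e \<in> edges G. ends G e = {u, v}}"
      using ends by blast
    finally have "{e \<in> edges H. ends H e = {f u, f v}} = g ` {e \<in> edges G. ends G e = {u, v}}" .
    moreover have "inj_on g {e \<in> edges G. ends G e = {u, v}}"
      using fg(2) unfolding bij_betw_def by (auto intro: inj_on_subset)
    ultimately show ?thesis by (simp add: mult_def card_image)
  qed
  then show ?thesis using that fg(1) by blast
qed

text \<open>The converse becomes a finite check on the table \<open>t\<close>: the matchings through
  an edge joining the vertices with indices \<open>i\<close> and \<open>j\<close> are counted on the
  remaining indices.\<close>

lemma matching_double_covered_isomorphic:
  fixes G :: "('v, 'e) mgraph" and H :: "('w, 'f) mgraph"
  assumes con: "connected_graph G" and iso: "isomorphic G H"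
    and ys: "distinct ys" "set ys = verts H" "length ys = n"
    and t: "\<And>i j. i < n \<Longrightarrow> j < n \<Longrightarrow> mult H (ys ! i) (ys ! j) = t i j"
    and two: "\<forall>i\<in>set [0..<n]. \<forall>j\<in>set [0..<n]. t i j \<noteq> 0 \<longrightarrow>
      matching_count t (filter (\<lambda>k. k \<noteq> i \<and> k \<noteq> j) [0..<n]) = 2"
  shows "matching_double_covered G"
proof -
  have G: "graph G" using con by (simp add: connected_graph_def)
  obtain f where f: "bij_betw f (verts G) (verts H)"
    "\<And>u v. u \<in> verts G \<Longrightarrow> v \<in> verts G \<Longrightarrow> mult H (f u) (f v) = mult G u v"
    using isomorphic_mult[OF G iso] by blast
  define h where "h i = inv_into (verts G) f (ys ! i)" for i
  have "bij_betw ((!) ys) {..<n} (verts H)" using bij_betw_nth[of ys "{..<n}" "verts H"] ys by simp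
  moreover have inv: "bij_betw (inv_into (verts G) f) (verts H) (verts G)"
    by (rule bij_betw_inv_into[OF f(1)])
  ultimately have h: "bij_betw h {..<n} (verts G)"
    unfolding h_def using bij_betw_trans[of "(!) ys" _ _ "inv_into (verts G) f"] by (simp add: o_def)
  have hV: "h i \<in> verts G" "f (h i) = ys ! i" if "i < n" for i
  proof -
    show "h i \<in> verts G" using h that by (auto simp: bij_betw_def)
    have "ys ! i \<in> verts H" unfolding ys(2)[symmetric] using that by (intro nth_mem) (simp add: ys(3))
    then show "f (h i) = ys ! i" unfolding h_def by (rule bij_betw_inv_into_right[OF f(1)])
  qed
  have mh: "mult G (h i) (h j) = t i j" if "i < n" "j < n" for i j
    using f(2)[OF hV(1)[OF that(1)] hV(1)[OF that(2)]] hV(2) that t by simp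
  have inj: "inj_on h {..<n}" using h by (simp add: bij_betw_def)
  have "card {M. perfect_matching G M \<and> e \<in> M} = 2" if e: "e \<in> edges G" for e
  proof -
    obtain p q where pq: "ends G e = {p, q}" "p \<in> verts G" "q \<in> verts G"
      using ends_obtain[OF G e] by metis
    have "p \<in> h ` {..<n}" "q \<in> h ` {..<n}" using pq h by (simp_all add: bij_betw_def)
    then obtain i j where ij: "i < n" "j < n" "p = h i" "q = h j" by blast
    let ?L = "filter (\<lambda>k. k \<noteq> i \<and> k \<noteq> j) [0..<n]"
    have L: "set ?L = {..<n} - {i, j}" by auto
    have "t i j > 0" using mh[OF ij(1,2)] mult_pos_iff[OF G] e pq ij by metis
    then have "matching_count t ?L = 2" using two ij by simp
    moreover have "matching_count (mult G) (map h ?L) = matching_count t ?L"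
      by (rule matching_count_map) (use inj mh in \<open>auto simp: inj_on_def\<close>)
    moreover have "card {M. perfect_matching G M \<and> e \<in> M} = matching_count (mult G) (map h ?L)"
    proof (rule card_perfect_matchings_edge[OF G e pq(1)])
      show "distinct (map h ?L)" using inj by (auto simp: distinct_map inj_on_def)
      have "set (map h ?L) = h ` ({..<n} - {i, j})" unfolding set_map L ..
      also have "\<dots> = h ` {..<n} - h ` {i, j}"
        using inj ij by (intro inj_on_image_set_diff[of h "{..<n}"]) auto
      finally show "set (map h ?L) = verts G - {p, q}" using h ij by (simp add: bij_betw_def)
    qed
    ultimately show ?thesis by simp
  qed
  then show ?thesis using con by (simp add: matching_double_covered_def)
qed

section \<open>Multiplicity tables of the three graphs\<close>

lemma mult_simple_graph: "mult (simple_graph V E) u v = (if {u, v} \<in> E then 1 else 0)"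
proof -
  have "{e \<in> E. e = {u, v}} = (if {u, v} \<in> E then {{u, v}} else {})" by auto
  then show ?thesis by (simp add: mult_def simple_graph_def)
qed

lemma doubleton_in_all_pairs: "{u, v} \<in> all_pairs V \<longleftrightarrow> u \<in> V \<and> v \<in> V \<and> u \<noteq> v"
  by (auto simp: all_pairs_def card_insert_if)

lemma finite_all_pairs: "finite V \<Longrightarrow> finite (all_pairs V)"
  by (rule finite_subset[of _ "Pow V"]) (auto simp: all_pairs_def)

lemma graph_simple_graph:
  assumes "finite V" "E \<subseteq> all_pairs V" shows "graph (simple_graph V E)"
  using assms finite_subset[OF assms(2) finite_all_pairs[OF assms(1)]]
  by (auto simp: graph_def simple_graph_def all_pairs_def)

lemma graph_K4_6: "graph K4_6"
  by (auto simp: graph_def K4_6_def finite_all_pairs) (auto simp: all_pairs_def)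

lemma mult_K4_6:
  assumes "i < 4" "j < 4" shows "mult K4_6 i j = (if i = j then 0 else 2)"
proof (cases "i = j")
  case False
  have "{i, j} \<in> all_pairs {..<4}" using assms False by (simp add: doubleton_in_all_pairs)
  moreover have "{e \<in> A \<times> UNIV. fst e = P} = {P} \<times> (UNIV :: bool set)" if "P \<in> A" for P and A :: "nat set set"
    using that by auto
  ultimately have "{e \<in> edges K4_6. ends K4_6 e = {i, j}} = {{i, j}} \<times> UNIV"
    by (simp only: K4_6_def mgraph.simps)
  then show ?thesis using False by (simp add: mult_def)
qed (simp add: mult_self[OF graph_K4_6])

lemma C6_edges_eq: "C6_edges = {{0, 1}, {1, 2}, {2, 3}, {3, 4}, {4, 5}, {5, 0}}"
proof -
  have six: "{i :: nat. i < 6} = {0, 1, 2, 3, 4, 5}" by auto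
  have "Suc 0 mod 6 = 1" "Suc 1 mod 6 = 2" "Suc 2 mod 6 = 3" "Suc 3 mod 6 = 4" "Suc 4 mod 6 = 5" "Suc 5 mod 6 = 0"
    by simp_all
  note mods = this
  have "C6_edges = (\<lambda>i. {i, Suc i mod 6}) ` {i. i < 6}" by (auto simp: C6_edges_def)
  then show ?thesis unfolding six image_insert image_empty mods .
qed

lemma graph_T1: "graph T1"
  unfolding T1_def by (rule graph_simple_graph) (auto simp: doubleton_in_all_pairs)

lemma mult_T1:
  assumes "i < 6" "j < 6" shows "mult T1 i j = octa i j"
proof -
  have "\<forall>i<6. \<forall>j<6. {i, j} \<in> (all_pairs {..<6} - C6_edges) \<union> {{0, 1}, {2, 3}, {4, 5}} \<longleftrightarrow>
      i \<noteq> j \<and> {i, j} \<notin> {{0, 5}, {1, 2}, {3, 4}}"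
    by (simp add: numeral_eq_Suc All_less_Suc C6_edges_eq doubleton_in_all_pairs doubleton_eq_iff)
  then show ?thesis using assms by (simp add: T1_def mult_simple_graph octa_def)
qed

text \<open>The order is chosen so that disjointness reproduces \<open>petersen_nb\<close>:
  \<open>{0, 1}\<close>, the three pairs disjoint from it, then the further neighbours of
  each.\<close>

definition petersen_verts :: "nat set list" where
  "petersen_verts = [{0, 1}, {2, 3}, {2, 4}, {3, 4}, {0, 4}, {1, 4}, {1, 3}, {0, 3}, {1, 2}, {0, 2}]"

lemma distinct_petersen_verts: "distinct petersen_verts"
  by (simp add: petersen_verts_def doubleton_eq_iff)

lemma length_petersen_verts: "length petersen_verts = 10"
  by (simp add: petersen_verts_def)

lemma set_petersen_verts: "set petersen_verts = all_pairs {..<5}"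
proof (rule card_subset_eq)
  show "finite (all_pairs {..<5 :: nat})" by (simp add: finite_all_pairs)
  show "set petersen_verts \<subseteq> all_pairs {..<5}"
    by (simp add: petersen_verts_def doubleton_in_all_pairs)
  have "card (all_pairs {..<5 :: nat}) = 5 choose 2"
    unfolding all_pairs_def by (simp add: n_subsets)
  also have "\<dots> = 10" by code_simp
  finally show "card (set petersen_verts) = card (all_pairs {..<5 :: nat})"
    using distinct_card[OF distinct_petersen_verts] length_petersen_verts by simp
qed

lemma petersen_verts_inter:
  "\<forall>i<10. \<forall>j<10. petersen_verts ! i \<inter> petersen_verts ! j = {} \<longleftrightarrow> j \<in> set (petersen_nb ! i)"
  by (simp add: petersen_verts_def petersen_nb_def numeral_eq_Suc All_less_Suc)

lemma verts_petersen: "verts petersen = all_pairs {..<5}"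
  by (simp add: petersen_def simple_graph_def)

lemma graph_petersen: "graph petersen"
  unfolding petersen_def
proof (rule graph_simple_graph)
  show "finite (all_pairs {..<5 :: nat})" by (simp add: finite_all_pairs)
  show "{{A, B} |A B. A \<in> all_pairs {..<5} \<and> B \<in> all_pairs {..<5} \<and> A \<inter> B = {}}
    \<subseteq> all_pairs (all_pairs {..<5 :: nat})"
    by (auto simp: doubleton_in_all_pairs) (auto simp: all_pairs_def)
qed

lemma mult_petersen:
  assumes "i < 10" "j < 10"
  shows "mult petersen (petersen_verts ! i) (petersen_verts ! j) = petersen_table i j"
proof -
  have "petersen_verts ! i \<in> all_pairs {..<5}" "petersen_verts ! j \<in> all_pairs {..<5}"
    unfolding set_petersen_verts[symmetric] using assms length_petersen_verts by simp_all
  then have "{petersen_verts ! i, petersen_verts ! j} \<in>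
      {{A, B} |A B. A \<in> all_pairs {..<5} \<and> B \<in> all_pairs {..<5} \<and> A \<inter> B = {}} \<longleftrightarrow>
      petersen_verts ! i \<inter> petersen_verts ! j = {}"
    by (auto simp: doubleton_eq_iff)
  then show ?thesis
    using petersen_verts_inter assms by (simp add: petersen_def mult_simple_graph petersen_table_def)
qed

lemma sum_list_map_nonzero:
  fixes f g :: "'a \<Rightarrow> 'b::semiring_0"
  shows "(\<Sum>x\<leftarrow>xs. f x * g x) = (\<Sum>x\<leftarrow>filter (\<lambda>x. f x \<noteq> 0) xs. f x * g x)"
  by (induction xs) auto

text \<open>Code equations that prune the recursion, for the evaluation on the three graphs.\<close>
lemma matching_count_code [code]:
  "matching_count m [] = 1"
  "matching_count m (v # vs) = (\<Sum>u\<leftarrow>filter (\<lambda>u. m v u \<noteq> 0) vs. m v u * matching_count m (remove1 u vs))"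
  unfolding matching_count.simps by (rule refl, rule sum_list_map_nonzero)

section \<open>Finite checks for the converse\<close>

lemma matching_count_K4:
  "\<forall>i\<in>set [0..<4]. \<forall>j\<in>set [0..<4]. (if i = j then 0 else 2 :: nat) \<noteq> 0 \<longrightarrow>
    matching_count (\<lambda>i j. if i = j then 0 else 2) (filter (\<lambda>k. k \<noteq> i \<and> k \<noteq> j) [0..<4]) = 2"
  by code_simp

lemma matching_count_octa:
  "\<forall>i\<in>set [0..<6]. \<forall>j\<in>set [0..<6]. octa i j \<noteq> 0 \<longrightarrow>
    matching_count octa (filter (\<lambda>k. k \<noteq> i \<and> k \<noteq> j) [0..<6]) = 2"
  by code_simp

lemma matching_count_petersen:
  "\<forall>i\<in>set [0..<10]. \<forall>j\<in>set [0..<10]. petersen_table i j \<noteq> 0 \<longrightarrow>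
    matching_count petersen_table (filter (\<lambda>k. k \<noteq> i \<and> k \<noteq> j) [0..<10]) = 2"
  by code_simp

theorem corollary1p10:
  fixes G :: "('v, 'e) mgraph"
  assumes "brick G"
  shows "matching_double_covered G \<longleftrightarrow>
    isomorphic G petersen \<or> isomorphic G T1 \<or> isomorphic G K4_6"
proof
  assume dc: "matching_double_covered G"
  then have G: "graph G" by (simp add: matching_double_covered_def connected_graph_def)
  obtain d where d: "double_covered_multiplicity (verts G) (mult G) d"
    using brick_double_covered_multiplicity[OF assms dc] by blast
  obtain xs where xs: "distinct xs" "set xs = verts G"
    "length xs = 4 \<and> (\<forall>i<4. \<forall>j<4. mult G (xs ! i) (xs ! j) = (if i = j then 0 else 2)) \<or>
     length xs = 6 \<and> (\<forall>i<6. \<forall>j<6. mult G (xs ! i) (xs ! j) = octa i j) \<or>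
     length xs = 10 \<and> (\<forall>i<10. \<forall>j<10. mult G (xs ! i) (xs ! j) = petersen_table i j)"
    by (rule exE[OF double_covered_multiplicity.classification[OF d]]) (elim conjE, rule that)
  from xs(3) show "isomorphic G petersen \<or> isomorphic G T1 \<or> isomorphic G K4_6"
  proof (elim disjE conjE)
    assume "length xs = 4" "\<forall>i<4. \<forall>j<4. mult G (xs ! i) (xs ! j) = (if i = j then 0 else 2)"
    then have "isomorphic G K4_6"
      by (intro isomorphicI_nth[OF G graph_K4_6 xs(1,2), of "[0..<4]" 4])
        (simp_all add: mult_K4_6, auto simp: K4_6_def)
    then show ?thesis by blast
  next
    assume "length xs = 6" "\<forall>i<6. \<forall>j<6. mult G (xs ! i) (xs ! j) = octa i j"
    then have "isomorphic G T1"
      by (intro isomorphicI_nth[OF G graph_T1 xs(1,2), of "[0..<6]" 6])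
        (simp_all add: mult_T1, auto simp: T1_def simple_graph_def)
    then show ?thesis by blast
  next
    assume "length xs = 10" "\<forall>i<10. \<forall>j<10. mult G (xs ! i) (xs ! j) = petersen_table i j"
    then have "isomorphic G petersen"
      by (intro isomorphicI_nth[OF G graph_petersen xs(1,2) distinct_petersen_verts, of 10])
        (simp_all add: mult_petersen set_petersen_verts verts_petersen length_petersen_verts)
    then show ?thesis by blast
  qed
next
  have con: "connected_graph G" using assms by (simp add: brick_def matching_covered_def)
  assume "isomorphic G petersen \<or> isomorphic G T1 \<or> isomorphic G K4_6"
  then show "matching_double_covered G"
  proof (elim disjE)
    assume "isomorphic G petersen"
    then show ?thesis
      by (rule matching_double_covered_isomorphic[OF con _ distinct_petersen_verts _ _ _ matching_count_petersen])
        (simp_all add: mult_petersen set_petersen_verts verts_petersen length_petersen_verts)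
  next
    assume "isomorphic G T1"
    then show ?thesis
      by (rule matching_double_covered_isomorphic[OF con _ _ _ _ _ matching_count_octa, where ys = "[0..<6]"])
        (simp_all add: mult_T1, auto simp: T1_def simple_graph_def)
  next
    assume "isomorphic G K4_6"
    then show ?thesis
      by (rule matching_double_covered_isomorphic[OF con _ _ _ _ _ matching_count_K4, where ys = "[0..<4]"])
        (simp_all add: mult_K4_6, auto simp: K4_6_def)
  qed
qed

end
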